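(* Let $a_0<a_1<a_2<a_3$ be real numbers and let $\lambda_1,\lambda_2$ be given constants. Let $w_1:(a_0,a_1)\to\mathbb{C}$, $w_2:(a_1,a_2)\to\mathbb{C}$, $w_3:(a_2,a_3)\to\mathbb{C}$ be solutions of the Fuchsian equation $$\prod_{j=0}^3 (s-a_j)\left[w''+\frac12 \sum_{j=0}^3\frac{1}{s-a_j}\, w'\right] +\left(\frac{3}{16}s^2+\lambda_1 s+\lambda_2\right)w =0$$ on their respective intervals. Then the function $$u(x,y,z)=(x^2+y^2+z^2+1)^{-1/2}\,w_1(s_1)\,w_2(s_2)\,w_3(s_3),$$ where $s_1,s_2,s_3$ are the 5-cyclide coordinates of $(x,y,z)$, is harmonic on the set $$T=\{(x,y,z)\in\mathbb{R}^3: x,y,z>0,\ x^2+y^2+z^2>1\}.$$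
   Context: 5-cyclide coordinates on $T$: for $(x,y,z)\in T$, the coordinates $s_1,s_2,s_3$ with $a_0<s_1<a_1<s_2<a_2<s_3<a_3$ are the three solutions $s$ of $$\frac{(x^2+y^2+z^2-1)^2}{s-a_0}+ \frac{4x^2}{s-a_1}+\frac{4y^2}{s-a_2}+ \frac{4z^2}{s-a_3}=0 .$$ A (possibly complex-valued) function is harmonic if it satisfies Laplace's equation $u_{xx}+u_{yy}+u_{zz}=0$. *)

theory Defs
  imports "HOL-Analysis.Analysis"
begin

definition has_partial_deriv ::
  "(real^'n \<Rightarrow> 'b::real_normed_vector) \<Rightarrow> 'n::finite \<Rightarrow> 'b \<Rightarrow> real^'n \<Rightarrow> bool" where
  "has_partial_deriv u i d p \<longleftrightarrow>
     ((\<lambda>t. u (p + t *\<^sub>R axis i 1)) has_vector_derivative d) (at 0)"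

(* Harmonic in the classical sense: all partial derivatives up to second order exist and are
   continuous, and Laplace's equation holds. Here g i is the first partial derivative and
   h i j the second one (first along i, then along j). As S is open, neither depends on the
   values of u outside S. *)
definition harmonic_on ::
  "(real^'n \<Rightarrow> 'b::real_normed_vector) \<Rightarrow> (real^'n::finite) set \<Rightarrow> bool" where
  "harmonic_on u S \<longleftrightarrow> open S \<and>
     (\<exists>g h. continuous_on S u \<and>
        (\<forall>i. continuous_on S (g i)) \<and>
        (\<forall>i j. continuous_on S (h i j)) \<and>
        (\<forall>p\<in>S. \<forall>i. has_partial_deriv u i (g i p) p) \<and>
        (\<forall>p\<in>S. \<forall>i j. has_partial_deriv (g i) j (h i j p) p) \<and>
        (\<forall>p\<in>S. (\<Sum>i\<in>UNIV. h i i p) = 0))"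

definition T_region :: "(real^3) set" where
  "T_region = {p. p$1 > 0 \<and> p$2 > 0 \<and> p$3 > 0 \<and> (p$1)^2 + (p$2)^2 + (p$3)^2 > 1}"

definition cyclide_fun :: "(nat \<Rightarrow> real) \<Rightarrow> real^3 \<Rightarrow> real \<Rightarrow> real" where
  "cyclide_fun a p s =
     ((p$1)^2 + (p$2)^2 + (p$3)^2 - 1)^2 / (s - a 0)
     + 4 * (p$1)^2 / (s - a 1) + 4 * (p$2)^2 / (s - a 2) + 4 * (p$3)^2 / (s - a 3)"

(* The poles a j are excluded explicitly, because x / 0 = 0. On T_region there is
   exactly one triple with this property. *)
definition cyclide_coords :: "(nat \<Rightarrow> real) \<Rightarrow> real^3 \<Rightarrow> real \<times> real \<times> real" where
  "cyclide_coords a p = (THE (s1, s2, s3).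
     a 0 < s1 \<and> s1 < a 1 \<and> a 1 < s2 \<and> s2 < a 2 \<and> a 2 < s3 \<and> s3 < a 3 \<and>
     {s. s \<notin> a ` {..3} \<and> cyclide_fun a p s = 0} = {s1, s2, s3})"

(* Only meant for open intervals I that contain no a j. *)
definition fuchsian_solution ::
  "(nat \<Rightarrow> real) \<Rightarrow> complex \<Rightarrow> complex \<Rightarrow> real set \<Rightarrow> (real \<Rightarrow> complex) \<Rightarrow> bool" where
  "fuchsian_solution a lam1 lam2 I w \<longleftrightarrow>
     (\<exists>w' w''. \<forall>s\<in>I.
        (w has_vector_derivative w' s) (at s) \<and>
        (w' has_vector_derivative w'' s) (at s) \<and>
        (\<Prod>j\<le>3. of_real (s - a j)) *
            (w'' s + 1/2 * (\<Sum>j\<le>3. 1 / of_real (s - a j)) * w' s)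
          + (3/16 * (of_real s)^2 + lam1 * of_real s + lam2) * w s = 0)"

end

theory Submission
  imports Defs
begin

text \<open>
  Write \<open>X = |p|\<^sup>2 - 1\<close>, \<open>R = |p|\<^sup>2 + 1\<close>, and let \<open>A(s)\<close> be the sum of the four reciprocals
  \<open>1 / (s - a\<^sub>j)\<close>. The vector \<open>(X, 2x, 2y, 2z) / R\<close> is the inverse stereographic image of \<open>p\<close> on
  the unit three-sphere. In these coordinates the equation for \<open>s\<close> is homogeneous of degree two and
  defines sphero-conal coordinates, in which the Laplace-Beltrami operator of the sphere separates;
  the factor \<open>R\<close> to the power \<open>-1/2\<close> is the conformal weight that turns the Euclidean Laplacian into
  the conformal Laplacian of the sphere. The proof carries this out in the Euclidean coordinates.

  Let \<open>s\<close> be one root of the equation as a function of \<open>p\<close>, and let \<open>N > 0\<close> be minus the derivative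
  in \<open>s\<close> of its left-hand side. Implicit differentiation and the equation itself give
  \<open>|\<nabla>s|\<^sup>2 = 16 / N\<close>, orthogonality of the gradients of two different roots, and
  \<open>\<Delta>s - (\<nabla>R / R) \<bullet> \<nabla>s = 8 A(s) / N\<close>
  (\<open>gradient_norm\<close>, \<open>gradients_orthogonal\<close>, \<open>laplacian_root\<close>, \<open>gradient_dot_radial\<close>). Therefore the
  operator \<open>\<Delta> - (\<nabla>R / R) \<bullet> \<nabla>\<close> maps \<open>w(s)\<close> to
  \<open>(16 / N) (w''(s) + A(s) w'(s) / 2)\<close> (\<open>conformal_laplacian_compose\<close>), and it acts as a derivation on
  the product of the three factors, because their gradients are orthogonal.

  By the Fuchsian equation, the operator multiplies the factor \<open>w\<^sub>i(s\<^sub>i)\<close> by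
  \<open>- 16 Q(s\<^sub>i) / (N\<^sub>i P(s\<^sub>i))\<close>, where \<open>Q(s) = 3/16 s\<^sup>2 + \<lambda>\<^sub>1 s + \<lambda>\<^sub>2\<close> and \<open>P(s)\<close> is the product of
  the \<open>s - a\<^sub>j\<close>. Clearing denominators turns the defining equation into a cubic with leading
  coefficient \<open>R\<^sup>2\<close> whose roots are the three coordinates; so \<open>N\<^sub>i P(s\<^sub>i)\<close> is \<open>-R\<^sup>2\<close> times the product of
  the differences of \<open>s\<^sub>i\<close> from the other two roots (\<open>slope_at_root\<close>). Lagrange interpolation of the
  quadratic polynomial \<open>Q\<close> at the three roots then adds up the three multipliers to \<open>16 / R\<^sup>2\<close> times
  the leading coefficient \<open>3/16\<close>, whatever \<open>\<lambda>\<^sub>1\<close> and \<open>\<lambda>\<^sub>2\<close> are (\<open>separation_of_variables\<close>). The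
  resulting eigenvalue \<open>3 / R\<^sup>2\<close> is cancelled by the Laplacian of the weight, which is
  \<open>- 3 / R\<^sup>2\<close> times the weight (\<open>weight_jet\<close>).

  On the analytic side, a root is continuous because the left-hand side decreases strictly in \<open>s\<close>
  between consecutive poles, and it is differentiable because the difference of the left-hand side
  at two parameters is exactly their difference times a continuous nonvanishing factor.
\<close>

section \<open>Partial derivatives of first and second order\<close>

text \<open>The derivatives are recorded as explicit families of functions, since they enter further
  computations: \<open>g k\<close> is the derivative along the \<open>k\<close>-th axis, and \<open>h k l\<close> that of \<open>g k\<close> along the
  \<open>l\<close>-th.\<close>

definition C1_with ::
  "(real^'n::finite) set \<Rightarrow> (real^'n \<Rightarrow> 'b::real_normed_vector) \<Rightarrow> ('n \<Rightarrow> real^'n \<Rightarrow> 'b) \<Rightarrow> bool" where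
  "C1_with S u g \<longleftrightarrow> continuous_on S u \<and>
     (\<forall>k. continuous_on S (g k) \<and> (\<forall>p\<in>S. has_partial_deriv u k (g k p) p))"

definition C2_with ::
  "(real^'n::finite) set \<Rightarrow> (real^'n \<Rightarrow> 'b::real_normed_vector) \<Rightarrow> ('n \<Rightarrow> real^'n \<Rightarrow> 'b) \<Rightarrow>
     ('n \<Rightarrow> 'n \<Rightarrow> real^'n \<Rightarrow> 'b) \<Rightarrow> bool" where
  "C2_with S u g h \<longleftrightarrow> C1_with S u g \<and> (\<forall>k. C1_with S (g k) (h k))"

lemma harmonic_onI:
  assumes "open S" "C2_with S u g h" "\<And>p. p \<in> S \<Longrightarrow> (\<Sum>k\<in>UNIV. h k k p) = 0"
  shows "harmonic_on u S"
  using assms unfolding harmonic_on_def C2_with_def C1_with_def by blast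

lemma has_partial_deriv_real:
  fixes u :: "real^'n::finite \<Rightarrow> real"
  shows "has_partial_deriv u k d p \<longleftrightarrow>
    ((\<lambda>t. u (p + t *\<^sub>R axis k 1)) has_real_derivative d) (at 0)"
  by (simp add: has_partial_deriv_def has_real_derivative_iff_has_vector_derivative)

lemma line_component: "(p + t *\<^sub>R axis k 1) $ j = p $ j + t * (if j = k then 1 else 0)"
  for p :: "real^'n::finite"
  by (simp add: axis_def)

lemma line_norm_square:
  "(p + t *\<^sub>R axis k 1) \<bullet> (p + t *\<^sub>R axis k 1) = p \<bullet> p + 2 * t * (p $ k) + t\<^sup>2"
  for p :: "real^'n::finite"
  by (simp add: inner_add_left inner_add_right inner_axis inner_axis' inner_axis_axis
      inner_commute[of "axis k 1" p] power2_eq_square algebra_simps)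

lemma eventually_line_in_open:
  fixes p :: "real^'n::finite"
  assumes "open S" "p \<in> S"
  shows "\<forall>\<^sub>F t in nhds 0. p + t *\<^sub>R axis k 1 \<in> S"
proof -
  let ?q = "\<lambda>t::real. p + t *\<^sub>R axis k 1"
  have "isCont ?q 0"
    by (intro continuous_intros)
  then have "(?q \<longlongrightarrow> ?q 0) (nhds 0)"
    using tendsto_at_iff_tendsto_nhds[of ?q 0] unfolding continuous_at by blast
  then show ?thesis
    using assms by (auto dest: topological_tendstoD)
qed

lemma isCont_along_line:
  fixes p :: "real^'n::finite" and f :: "real^'n \<Rightarrow> 'b::topological_space"
  assumes "open S" "p \<in> S" "continuous_on S f"
  shows "isCont (\<lambda>t::real. f (p + t *\<^sub>R axis k 1)) 0"
proof (rule isCont_o2)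
  show "isCont (\<lambda>t::real. p + t *\<^sub>R axis k 1) 0"
    by (intro continuous_intros)
  show "isCont f (p + 0 *\<^sub>R axis k 1)"
    using assms by (simp add: continuous_on_eq_continuous_at)
qed

lemma (in bounded_bilinear) C1_with_bilinear:
  assumes "C1_with S u g" "C1_with S v h"
  shows "C1_with S (\<lambda>p. prod (u p) (v p)) (\<lambda>k p. prod (u p) (h k p) + prod (g k p) (v p))"
proof -
  have "has_partial_deriv (\<lambda>p. prod (u p) (v p)) k (prod (u p) (h k p) + prod (g k p) (v p)) p"
    if "p \<in> S" for k p
    using assms that has_vector_derivative[of "\<lambda>t. u (p + t *\<^sub>R axis k 1)" "g k p" 0 UNIV
        "\<lambda>t. v (p + t *\<^sub>R axis k 1)" "h k p"]
    by (simp add: C1_with_def has_partial_deriv_def)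
  then show ?thesis
    using assms by (auto simp: C1_with_def intro!: continuous_on_add continuous_on)
qed

lemmas C1_with_mult = bounded_bilinear.C1_with_bilinear[OF bounded_bilinear_mult]
lemmas C1_with_scaleR = bounded_bilinear.C1_with_bilinear[OF bounded_bilinear_scaleR]

lemma C1_with_add:
  assumes "C1_with S u g" "C1_with S v h"
  shows "C1_with S (\<lambda>p. u p + v p) (\<lambda>k p. g k p + h k p)"
  using assms unfolding C1_with_def has_partial_deriv_def
  by (auto intro!: continuous_on_add has_vector_derivative_add)

lemma C1_with_compose:
  fixes f :: "real^'n::finite \<Rightarrow> real"
  assumes f: "C1_with S f g" "f ` S \<subseteq> I"
    and w: "\<And>s. s \<in> I \<Longrightarrow> (w has_vector_derivative w' s) (at s)" "continuous_on I w'"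
  shows "C1_with S (\<lambda>p. w (f p)) (\<lambda>k p. g k p *\<^sub>R w' (f p))"
proof -
  have "continuous_on I w"
    using w(1) by (meson continuous_at_imp_continuous_on has_vector_derivative_continuous)
  moreover have "has_partial_deriv (\<lambda>p. w (f p)) k (g k p *\<^sub>R w' (f p)) p" if "p \<in> S" for k p
  proof -
    have "((\<lambda>t. f (p + t *\<^sub>R axis k 1)) has_vector_derivative g k p) (at 0)"
      using f that by (auto simp: C1_with_def has_partial_deriv_def)
    moreover have "(w has_vector_derivative w' (f p)) (at (f (p + 0 *\<^sub>R axis k 1)))"
      using f that w(1) by auto
    ultimately show ?thesis
      unfolding has_partial_deriv_def by (rule vector_diff_chain_at[unfolded o_def])
  qed
  ultimately show ?thesis
    using f w(2) unfolding C1_with_def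
    by (auto intro!: continuous_on_scaleR intro: continuous_on_compose2[of I _ S f])
qed

lemma C1_with_divide:
  fixes u v :: "real^'n::finite \<Rightarrow> real"
  assumes "C1_with S u g" "C1_with S v h" "\<And>p. p \<in> S \<Longrightarrow> v p \<noteq> 0"
  shows "C1_with S (\<lambda>p. u p / v p) (\<lambda>k p. (g k p * v p - u p * h k p) / (v p)\<^sup>2)"
proof -
  have "has_partial_deriv (\<lambda>p. u p / v p) k ((g k p * v p - u p * h k p) / (v p)\<^sup>2) p"
    if "p \<in> S" for k p
    unfolding has_partial_deriv_real
    using assms that
    by (auto simp: C1_with_def has_partial_deriv_real power2_eq_square
        intro!: derivative_eq_intros)
  then show ?thesis
    using assms by (auto simp: C1_with_def intro!: continuous_intros)
qed

lemma C2_with_mult: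
  fixes u v :: "real^'n::finite \<Rightarrow> 'b::real_normed_algebra"
  assumes "C2_with S u g h" "C2_with S v g' h'"
  shows "C2_with S (\<lambda>p. u p * v p) (\<lambda>k p. u p * g' k p + g k p * v p)
    (\<lambda>k l p. (u p * h' k l p + g l p * g' k p) + (g k p * g' l p + h k l p * v p))"
  using assms unfolding C2_with_def
  by (intro conjI allI C1_with_mult C1_with_add) simp_all

lemma C2_with_compose:
  fixes f :: "real^'n::finite \<Rightarrow> real"
  assumes f: "C2_with S f g h" "f ` S \<subseteq> I"
    and w: "\<And>s. s \<in> I \<Longrightarrow> (w has_vector_derivative w' s) (at s)"
      "\<And>s. s \<in> I \<Longrightarrow> (w' has_vector_derivative w'' s) (at s)" "continuous_on I w''"
  shows "C2_with S (\<lambda>p. w (f p)) (\<lambda>k p. g k p *\<^sub>R w' (f p))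
    (\<lambda>k l p. g k p *\<^sub>R (g l p *\<^sub>R w'' (f p)) + h k l p *\<^sub>R w' (f p))"
proof -
  have "continuous_on I w'"
    using w(2) by (meson continuous_at_imp_continuous_on has_vector_derivative_continuous)
  then show ?thesis
    using f w unfolding C2_with_def
    by (intro conjI allI C1_with_compose[of S f g I] C1_with_scaleR) simp_all
qed

text \<open>The second factor need only be continuous, because the first one vanishes at the point. This
  is what makes an implicitly defined root differentiable before anything but its continuity is known.\<close>

lemma DERIV_mult_continuous_at_zero:
  fixes \<phi> m :: "real \<Rightarrow> real"
  assumes "(\<phi> has_real_derivative d) (at x)" "\<phi> x = 0" "isCont m x"
  shows "((\<lambda>t. \<phi> t * m t) has_real_derivative d * m x) (at x)"
proof -
  obtain q where q: "\<And>z. \<phi> z - \<phi> x = q z * (z - x)" "isCont q x" "q x = d"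
    using assms(1) by (auto simp: CARAT_DERIV)
  show ?thesis
    unfolding CARAT_DERIV
    using q(2,3) q(1)[unfolded assms(2) diff_0_right] assms(2,3)
    by (intro exI[of _ "\<lambda>z. q z * m z"]) (auto intro!: continuous_intros)
qed

lemma DERIV_quotient_square:
  fixes f h :: "real \<Rightarrow> real"
  assumes "(f has_real_derivative f') (at x)" "(h has_real_derivative h') (at x)" "h x \<noteq> 0"
  shows "((\<lambda>t. f t / (h t * h t)) has_real_derivative f' / (h x)\<^sup>2 - 2 * (f x / h x ^ 3) * h') (at x)"
  using assms(3)
  by (auto intro!: derivative_eq_intros assms(1,2) simp: field_simps power2_eq_square power3_eq_cube)

lemma DERIV_quotient:
  fixes f h :: "real \<Rightarrow> real"
  assumes "(f has_real_derivative f') (at x)" "(h has_real_derivative h') (at x)" "h x \<noteq> 0"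
  shows "((\<lambda>t. f t / h t) has_real_derivative f' / h x - f x / (h x)\<^sup>2 * h') (at x)"
  using assms(3)
  by (auto intro!: derivative_eq_intros assms(1,2) simp: field_simps power2_eq_square)

section \<open>The level function\<close>

text \<open>The left-hand side of the equation for \<open>s\<close>, in any dimension: \<open>c\<close> is the pole that belongs to
  the sphere and \<open>\<alpha>\<close> lists the poles that belong to the coordinate hyperplanes.\<close>

definition level :: "real \<Rightarrow> ('n::finite \<Rightarrow> real) \<Rightarrow> real^'n \<Rightarrow> real \<Rightarrow> real" where
  "level c \<alpha> p s = (p \<bullet> p - 1)\<^sup>2 / (s - c) + (\<Sum>j\<in>UNIV. 4 * (p$j)\<^sup>2 / (s - \<alpha> j))"

text \<open>Minus the divided difference of \<open>level\<close> in its last argument; on the diagonal, minus the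
  derivative.\<close>

definition slope :: "real \<Rightarrow> ('n::finite \<Rightarrow> real) \<Rightarrow> real^'n \<Rightarrow> real \<Rightarrow> real \<Rightarrow> real" where
  "slope c \<alpha> p s t = (p \<bullet> p - 1)\<^sup>2 / ((s - c) * (t - c)) +
     (\<Sum>j\<in>UNIV. 4 * (p$j)\<^sup>2 / ((s - \<alpha> j) * (t - \<alpha> j)))"

definition cubic_moment :: "real \<Rightarrow> ('n::finite \<Rightarrow> real) \<Rightarrow> real^'n \<Rightarrow> real \<Rightarrow> real" where
  "cubic_moment c \<alpha> p s = (p \<bullet> p - 1)\<^sup>2 / (s - c) ^ 3 + (\<Sum>j\<in>UNIV. 4 * (p$j)\<^sup>2 / (s - \<alpha> j) ^ 3)"

text \<open>The partial derivative of \<open>level\<close> along the \<open>k\<close>-th axis, with \<open>s\<close> kept fixed.\<close>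

definition level_deriv :: "real \<Rightarrow> ('n::finite \<Rightarrow> real) \<Rightarrow> 'n \<Rightarrow> real^'n \<Rightarrow> real \<Rightarrow> real" where
  "level_deriv c \<alpha> k p s = 4 * p$k * ((p \<bullet> p - 1) / (s - c) + 2 / (s - \<alpha> k))"

lemma level_diff:
  assumes "s \<noteq> c" "t \<noteq> c" "\<And>j. s \<noteq> \<alpha> j" "\<And>j. t \<noteq> \<alpha> j"
  shows "level c \<alpha> p s - level c \<alpha> p t = (t - s) * slope c \<alpha> p s t"
proof -
  have frac: "x / (s - d) - x / (t - d) = (t - s) * (x / ((s - d) * (t - d)))"
    if "s \<noteq> d" "t \<noteq> d" for x d
    using that by (simp add: field_simps)
  have "level c \<alpha> p s - level c \<alpha> p t = ((p \<bullet> p - 1)\<^sup>2 / (s - c) - (p \<bullet> p - 1)\<^sup>2 / (t - c)) +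
     (\<Sum>j\<in>UNIV. 4 * (p$j)\<^sup>2 / (s - \<alpha> j) - 4 * (p$j)\<^sup>2 / (t - \<alpha> j))"
    by (simp add: level_def sum_subtractf)
  also have "\<dots> = (t - s) * slope c \<alpha> p s t"
    unfolding slope_def distrib_left sum_distrib_left
    by (intro arg_cong2[of _ _ _ _ "(+)"] sum.cong refl frac assms)
  finally show ?thesis .
qed

lemma level_partial_deriv:
  assumes "s \<noteq> c" "\<And>j. s \<noteq> \<alpha> j"
  shows "has_partial_deriv (\<lambda>p. level c \<alpha> p s) k (level_deriv c \<alpha> k p s) p"
proof -
  have e: "(\<Sum>j\<in>UNIV. 8 * (p$j) * (if j = k then 1 else 0) / (s - \<alpha> j)) = 8 * p$k / (s - \<alpha> k)"
    by (subst sum.mono_neutral_right[of _ "{k}"]) auto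
  have D0: "((\<lambda>t. (p \<bullet> p + 2 * t * (p $ k) + t\<^sup>2 - 1)\<^sup>2 / (s - c)) has_real_derivative
      4 * p$k * (p \<bullet> p - 1) / (s - c)) (at 0)"
    by (rule DERIV_cdivide) (auto intro!: derivative_eq_intros)
  have D1: "((\<lambda>t. 4 * (p$j + t * (if j = k then 1 else 0))\<^sup>2 / (s - \<alpha> j)) has_real_derivative
      8 * (p$j) * (if j = k then 1 else 0) / (s - \<alpha> j)) (at 0)" for j
    by (rule DERIV_cdivide) (auto intro!: derivative_eq_intros)
  show ?thesis
    unfolding has_partial_deriv_real level_def line_norm_square line_component
    by (rule DERIV_cong[OF DERIV_add[OF D0 DERIV_sum[OF D1]]], unfold e)
      (simp add: level_deriv_def distrib_left)
qed

text \<open>Not all numerators of \<open>slope\<close> vanish: if \<open>p\<close> is the origin, then \<open>|p|\<^sup>2 - 1\<close> is not zero.\<close>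

lemma slope_pos:
  assumes "(s - c) * (t - c) > 0" "\<And>j. (s - \<alpha> j) * (t - \<alpha> j) > 0"
  shows "slope c \<alpha> p s t > 0"
proof (cases "p = 0")
  case True
  then show ?thesis
    using assms(1) by (simp add: slope_def)
next
  case False
  then obtain i where "p $ i \<noteq> 0"
    by (auto simp: vec_eq_iff)
  then have "(\<Sum>j\<in>UNIV. 4 * (p$j)\<^sup>2 / ((s - \<alpha> j) * (t - \<alpha> j))) > 0"
    using assms(2) by (intro sum_pos2[of _ i]) (auto simp: less_imp_le intro!: divide_nonneg_pos)
  then show ?thesis
    using assms(1) by (auto simp: slope_def intro!: add_nonneg_pos divide_nonneg_pos)
qed

text \<open>A choice of a root in a fixed gap \<open>(lo, hi)\<close> between poles. Nothing is assumed about its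
  regularity: within the gap the root is unique, and this already makes it continuous.\<close>

locale cyclide_root =
  fixes S :: "(real^'n::finite) set" and lo hi c :: real and \<alpha> :: "'n \<Rightarrow> real"
    and s :: "real^'n \<Rightarrow> real"
  assumes open_dom: "open S"
    and range: "\<And>p. p \<in> S \<Longrightarrow> lo < s p \<and> s p < hi"
    and poles: "c \<le> lo \<or> hi \<le> c" "\<And>j. \<alpha> j \<le> lo \<or> hi \<le> \<alpha> j"
    and root: "\<And>p. p \<in> S \<Longrightarrow> level c \<alpha> p (s p) = 0"
begin

lemma pole0: "p \<in> S \<Longrightarrow> s p \<noteq> c"
  using range poles(1) by force

lemma pole: "p \<in> S \<Longrightarrow> s p \<noteq> \<alpha> j"
  using range poles(2)[of j] by force

lemma slope_pos_interval:
  assumes "lo < x" "x < hi" "lo < y" "y < hi"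
  shows "slope c \<alpha> p x y > 0"
proof -
  have "(x - d) * (y - d) > 0" if "d \<le> lo \<or> hi \<le> d" for d
    using that assms by (auto intro: mult_pos_pos mult_neg_neg)
  then show ?thesis
    using poles by (intro slope_pos) auto
qed

lemma slope_nz: "p \<in> S \<Longrightarrow> slope c \<alpha> p (s p) (s p) \<noteq> 0"
  using slope_pos_interval[of "s p" "s p" p] range[of p] by simp

lemma level_sign:
  assumes "p \<in> S" "lo < x" "x < hi"
  shows "level c \<alpha> p x > 0 \<longleftrightarrow> x < s p" and "level c \<alpha> p x < 0 \<longleftrightarrow> s p < x"
proof -
  have nd: "x \<noteq> d" if "d \<le> lo \<or> hi \<le> d" for d
    using that assms by auto
  have eq: "level c \<alpha> p x = (s p - x) * slope c \<alpha> p x (s p)"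
    using level_diff[of x c "s p" \<alpha> p] nd poles pole0 pole root assms(1) by simp
  have pos: "slope c \<alpha> p x (s p) > 0"
    using slope_pos_interval range assms by simp
  show "level c \<alpha> p x > 0 \<longleftrightarrow> x < s p" "level c \<alpha> p x < 0 \<longleftrightarrow> s p < x"
    using pos by (auto simp: eq zero_less_mult_iff mult_less_0_iff)
qed

text \<open>Whether a fixed \<open>x\<close> lies below or above the root is decided by the sign of \<open>level\<close> at \<open>x\<close>, and
  that sign persists under small changes of the point.\<close>

lemma cont: "continuous_on S s"
  unfolding continuous_on_def
proof (intro ballI order_tendstoI)
  have cl: "((\<lambda>q. level c \<alpha> q x) \<longlongrightarrow> level c \<alpha> p x) (at p within S)" if "lo < x" "x < hi" for p x
  proof -
    have "x \<noteq> c" "x \<noteq> \<alpha> j" for j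
      using that poles(1) poles(2)[of j] by auto
    then show ?thesis
      unfolding level_def by (auto intro!: tendsto_intros)
  qed
  have inS: "\<forall>\<^sub>F q in at p within S. q \<in> S" for p
    by (simp add: eventually_at_filter)
  fix p b
  assume p: "p \<in> S"
  show "\<forall>\<^sub>F q in at p within S. b < s q" if b: "b < s p"
  proof -
    obtain x where x: "max lo b < x" "x < s p"
      using b range[OF p] dense[of "max lo b" "s p"] by (metis max_less_iff_conj)
    then have lx: "lo < x" "x < hi"
      using range[OF p] by auto
    have "\<forall>\<^sub>F q in at p within S. 0 < level c \<alpha> q x"
      using order_tendstoD(1)[OF cl[OF lx]] level_sign[OF p lx] x by blast
    with inS show ?thesis
      by eventually_elim (use level_sign[OF _ lx] x in force)
  qed
  show "\<forall>\<^sub>F q in at p within S. s q < b" if b: "s p < b"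
  proof -
    obtain x where x: "s p < x" "x < min hi b"
      using b range[OF p] dense[of "s p" "min hi b"] by (metis min_less_iff_conj)
    then have lx: "lo < x" "x < hi"
      using range[OF p] by auto
    have "\<forall>\<^sub>F q in at p within S. level c \<alpha> q x < 0"
      using order_tendstoD(2)[OF cl[OF lx]] level_sign[OF p lx] x by blast
    with inS show ?thesis
      by eventually_elim (use level_sign[OF _ lx] x in force)
  qed
qed

text \<open>The derivatives of the root, as implicit differentiation gives them. \<open>N\<close> and \<open>grad_num\<close> are the
  denominator and the numerator of the gradient, \<open>N_deriv\<close> and \<open>grad_num_deriv\<close> are their total
  partial derivatives, where the dependence of \<open>s\<close> on the point is taken into account, and \<open>hess\<close>
  comes from the quotient rule.\<close>

definition N where "N p = slope c \<alpha> p (s p) (s p)"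
definition grad_num where "grad_num k p = level_deriv c \<alpha> k p (s p)"
definition grad where "grad k p = grad_num k p / N p"

definition N_deriv where "N_deriv l p = 4 * p$l * ((p \<bullet> p - 1) / (s p - c)\<^sup>2 + 2 / (s p - \<alpha> l)\<^sup>2)
   - 2 * cubic_moment c \<alpha> p (s p) * grad l p"
definition grad_num_deriv where "grad_num_deriv k l p =
   4 * (if k = l then 1 else 0) * ((p \<bullet> p - 1) / (s p - c) + 2 / (s p - \<alpha> k)) +
   4 * p$k * (2 * p$l / (s p - c)
     - ((p \<bullet> p - 1) / (s p - c)\<^sup>2 + 2 / (s p - \<alpha> k)\<^sup>2) * grad l p)"
definition hess where "hess k l p = (grad_num_deriv k l p * N p - grad_num k p * N_deriv l p) / (N p)\<^sup>2"

lemma cont_N: "continuous_on S N"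
  unfolding N_def slope_def using cont pole0 pole by (auto intro!: continuous_intros)

lemma cont_num: "continuous_on S (grad_num k)"
  unfolding grad_num_def level_deriv_def using cont pole0 pole by (auto intro!: continuous_intros)

lemma N_nz: "p \<in> S \<Longrightarrow> N p \<noteq> 0"
  by (simp add: N_def slope_nz)

lemma cont_grad: "continuous_on S (grad k)"
  unfolding grad_def using cont_N cont_num N_nz by (auto intro!: continuous_intros)

text \<open>For \<open>q\<close> near \<open>p\<close>, the equation for \<open>s q\<close> and the divided difference give
  \<open>s q = s p + level c \<alpha> q (s p) / slope c \<alpha> q (s p) (s q)\<close>. The numerator is an explicit function
  of \<open>q\<close> that vanishes at \<open>p\<close>, and the denominator is continuous.\<close>

lemma partial_deriv_root:
  assumes p: "p \<in> S"
  shows "has_partial_deriv s k (grad k p) p"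
proof -
  define q where "q = (\<lambda>t::real. p + t *\<^sub>R axis k 1)"
  define m where "m = (\<lambda>t. slope c \<alpha> (q t) (s p) (s (q t)))"
  have q0 [simp]: "q 0 = p"
    by (simp add: q_def)
  have cs: "isCont (\<lambda>t. s (q t)) 0"
    unfolding q_def by (rule isCont_along_line[OF open_dom p cont])
  have cm: "isCont m 0"
    unfolding m_def slope_def
    using cs pole0[OF p] pole[OF p]
    by (auto simp: q_def intro!: continuous_intros)
  have m0: "m 0 = N p"
    by (simp add: m_def N_def)
  have "((\<lambda>t. level c \<alpha> (q t) (s p)) has_real_derivative grad_num k p) (at 0)"
    using level_partial_deriv[of "s p" c \<alpha> k p] pole0[OF p] pole[OF p]
    by (simp add: has_partial_deriv_real q_def grad_num_def)
  then have "((\<lambda>t. level c \<alpha> (q t) (s p) * inverse (m t)) has_real_derivative grad_num k p * inverse (m 0)) (at 0)"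
    using root[OF p] cm N_nz[OF p] m0
    by (intro DERIV_mult_continuous_at_zero) (auto intro!: continuous_intros)
  from DERIV_add[OF DERIV_const this]
  have D: "((\<lambda>t. s p + level c \<alpha> (q t) (s p) * inverse (m t)) has_real_derivative grad k p) (at 0)"
    by (simp add: grad_def m0 field_class.field_divide_inverse)
  have "(m \<longlongrightarrow> m 0) (nhds 0)"
    using cm tendsto_at_iff_tendsto_nhds[of m 0] unfolding continuous_at by blast
  then have "\<forall>\<^sub>F t in nhds 0. m t \<noteq> 0"
    using m0 N_nz[OF p] by (intro tendsto_imp_eventually_ne) auto
  then have ev: "\<forall>\<^sub>F t in nhds 0. s (q t) = s p + level c \<alpha> (q t) (s p) * inverse (m t)"
    using eventually_line_in_open[OF open_dom p, of k]
  proof eventually_elim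
    case (elim t)
    then have qt: "q t \<in> S"
      by (simp add: q_def)
    have "level c \<alpha> (q t) (s p) = (s (q t) - s p) * m t"
      using level_diff[of "s p" c "s (q t)" \<alpha> "q t"] pole0[OF p] pole[OF p] pole0[OF qt] pole[OF qt]
        root[OF qt] by (simp add: m_def)
    then show ?case
      using elim by (simp add: mult.assoc)
  qed
  then show ?thesis
    using D DERIV_cong_ev[OF refl ev refl, of "grad k p"] unfolding has_partial_deriv_real q_def by blast
qed

lemma C1_root: "C1_with S s grad"
  by (simp add: C1_with_def cont cont_grad partial_deriv_root)

lemma C1_N: "C1_with S N N_deriv"
proof -
  have "has_partial_deriv N l (N_deriv l p) p" if p: "p \<in> S" for l p
  proof -
    have D: "((\<lambda>t. s (p + t *\<^sub>R axis l 1)) has_real_derivative grad l p) (at 0)"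
      using partial_deriv_root[OF p] by (simp add: has_partial_deriv_real)
    have e: "(\<Sum>j\<in>UNIV. 8 * (p$j) * (if j = l then 1 else 0) / (s p - \<alpha> j)\<^sup>2) = 8 * p$l / (s p - \<alpha> l)\<^sup>2"
      by (subst sum.mono_neutral_right[of _ "{l}"]) auto
    have Dp: "((\<lambda>t. s (p + t *\<^sub>R axis l 1) - d) has_real_derivative grad l p) (at 0)" for d
      by (auto intro!: derivative_eq_intros D)
    have D0: "((\<lambda>t. (p \<bullet> p + 2 * t * (p $ l) + t\<^sup>2 - 1)\<^sup>2 /
         ((s (p + t *\<^sub>R axis l 1) - c) * (s (p + t *\<^sub>R axis l 1) - c))) has_real_derivative
         (4 * p$l * (p \<bullet> p - 1) / (s p - c)\<^sup>2 - 2 * ((p \<bullet> p - 1)\<^sup>2 / (s p - c)^3) * grad l p)) (at 0)"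
      by (rule DERIV_cong[OF DERIV_quotient_square[OF _ Dp]])
        (use pole0[OF p] in \<open>auto intro!: derivative_eq_intros\<close>)
    have D1: "((\<lambda>t. 4 * (p$j + t * (if j = l then 1 else 0))\<^sup>2 /
         ((s (p + t *\<^sub>R axis l 1) - \<alpha> j) * (s (p + t *\<^sub>R axis l 1) - \<alpha> j))) has_real_derivative
         (8 * (p$j) * (if j = l then 1 else 0) / (s p - \<alpha> j)\<^sup>2
           - 2 * (4 * (p$j)\<^sup>2 / (s p - \<alpha> j)^3) * grad l p)) (at 0)" for j
      by (rule DERIV_cong[OF DERIV_quotient_square[OF _ Dp]])
        (use pole[OF p] in \<open>auto intro!: derivative_eq_intros\<close>)
    show ?thesis
      unfolding has_partial_deriv_real N_def slope_def line_norm_square line_component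
      by (rule DERIV_cong[OF DERIV_add[OF D0 DERIV_sum[OF D1]]], unfold sum_subtractf e)
        (simp add: N_deriv_def cubic_moment_def algebra_simps sum_distrib_left)
  qed
  moreover have "continuous_on S (N_deriv l)" for l
    unfolding N_deriv_def cubic_moment_def using cont cont_grad pole0 pole by (auto intro!: continuous_intros)
  ultimately show ?thesis
    by (simp add: C1_with_def cont_N)
qed

lemma C1_num: "C1_with S (grad_num k) (grad_num_deriv k)"
proof -
  have "has_partial_deriv (grad_num k) l (grad_num_deriv k l p) p" if p: "p \<in> S" for l p
  proof -
    have D: "((\<lambda>t. s (p + t *\<^sub>R axis l 1)) has_real_derivative grad l p) (at 0)"
      using partial_deriv_root[OF p] by (simp add: has_partial_deriv_real)
    have Dp: "((\<lambda>t. s (p + t *\<^sub>R axis l 1) - d) has_real_derivative grad l p) (at 0)" for d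
      by (auto intro!: derivative_eq_intros D)
    have D0: "((\<lambda>t. (p \<bullet> p + 2 * t * (p $ l) + t\<^sup>2 - 1) / (s (p + t *\<^sub>R axis l 1) - c))
        has_real_derivative 2 * p$l / (s p - c) - (p \<bullet> p - 1) / (s p - c)\<^sup>2 * grad l p) (at 0)"
      by (rule DERIV_cong[OF DERIV_quotient[OF _ Dp]])
        (use pole0[OF p] in \<open>auto intro!: derivative_eq_intros\<close>)
    have D1: "((\<lambda>t. 2 / (s (p + t *\<^sub>R axis l 1) - \<alpha> k))
        has_real_derivative - (2 / (s p - \<alpha> k)\<^sup>2 * grad l p)) (at 0)"
      by (rule DERIV_cong[OF DERIV_quotient[OF DERIV_const Dp]]) (use pole[OF p] in auto)
    have D2: "((\<lambda>t. 4 * (p$k + t * (if k = l then 1 else 0)))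
        has_real_derivative 4 * (if k = l then 1 else 0)) (at 0)"
      by (auto intro!: derivative_eq_intros)
    show ?thesis
      unfolding has_partial_deriv_real grad_num_def level_deriv_def line_norm_square line_component
      by (rule DERIV_cong[OF DERIV_mult[OF D2 DERIV_add[OF D0 D1]]])
        (simp add: grad_num_deriv_def algebra_simps)
  qed
  moreover have "continuous_on S (grad_num_deriv k l)" for l
    unfolding grad_num_deriv_def using cont cont_grad pole0 pole by (auto intro!: continuous_intros)
  ultimately show ?thesis
    by (simp add: C1_with_def cont_num)
qed

lemma C2_root: "C2_with S s grad hess"
  unfolding C2_with_def using C1_root C1_with_divide[OF C1_num C1_N N_nz]
  by (simp add: grad_def[abs_def] hess_def[abs_def])

end

section \<open>Gradient and Laplacian of a root\<close>

lemma sum_square_affine_product: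
  fixes p :: "real^'n::finite"
  shows "(\<Sum>k\<in>UNIV. (p$k)\<^sup>2 * ((A + 2 * \<beta> k) * (B + 2 * \<gamma> k))) =
    A * B * (p \<bullet> p) + 2 * A * (\<Sum>k\<in>UNIV. (p$k)\<^sup>2 * \<gamma> k) + 2 * B * (\<Sum>k\<in>UNIV. (p$k)\<^sup>2 * \<beta> k)
      + 4 * (\<Sum>k\<in>UNIV. (p$k)\<^sup>2 * (\<beta> k * \<gamma> k))"
  by (simp add: inner_vec_def algebra_simps sum.distrib sum_distrib_left power2_eq_square)

text \<open>The form in which the equation for \<open>s\<close> eliminates sums that are of first order in the
  reciprocals \<open>1 / (s - \<alpha> k)\<close>.\<close>

lemma level_root_eq:
  assumes "level c \<alpha> p s = 0"
  shows "4 * (\<Sum>k\<in>UNIV. (p$k)\<^sup>2 * (1 / (s - \<alpha> k))) = - ((p \<bullet> p - 1)\<^sup>2 * (1 / (s - c)))"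
  using assms by (simp add: level_def sum_distrib_left mult.assoc add_eq_0_iff)

text \<open>The gradients are those of \<open>level\<close> at two different or equal values of the last argument, so
  this identity covers both the norm of the gradient of a root and the inner product for two roots.\<close>

lemma gradient_inner_product:
  assumes "level c \<alpha> p s = 0" "level c \<alpha> p t = 0"
  shows "(\<Sum>k\<in>UNIV. level_deriv c \<alpha> k p s * level_deriv c \<alpha> k p t) = 16 * slope c \<alpha> p s t"
proof -
  define X where "X = p \<bullet> p - 1"
  define b0 where "b0 = 1 / (s - c)"
  define d0 where "d0 = 1 / (t - c)"
  define b where "b k = 1 / (s - \<alpha> k)" for k
  define d where "d k = 1 / (t - \<alpha> k)" for k
  have b: "4 * (\<Sum>k\<in>UNIV. (p$k)\<^sup>2 * b k) = - (X\<^sup>2 * b0)"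
    unfolding b_def b0_def X_def by (rule level_root_eq[OF assms(1)])
  have d: "4 * (\<Sum>k\<in>UNIV. (p$k)\<^sup>2 * d k) = - (X\<^sup>2 * d0)"
    unfolding d_def d0_def X_def by (rule level_root_eq[OF assms(2)])
  have ls: "level_deriv c \<alpha> k p s = 4 * (p$k * (X * b0 + 2 * b k))" for k
    by (simp add: level_deriv_def X_def b0_def b_def)
  have lt: "level_deriv c \<alpha> k p t = 4 * (p$k * (X * d0 + 2 * d k))" for k
    by (simp add: level_deriv_def X_def d0_def d_def)
  have sl: "slope c \<alpha> p s t = X\<^sup>2 * b0 * d0 + 4 * (\<Sum>k\<in>UNIV. (p$k)\<^sup>2 * (b k * d k))"
    by (simp add: slope_def X_def b0_def d0_def b_def d_def sum_distrib_left mult.assoc)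
  have "(\<Sum>k\<in>UNIV. level_deriv c \<alpha> k p s * level_deriv c \<alpha> k p t) =
      16 * (\<Sum>k\<in>UNIV. (p$k)\<^sup>2 * ((X * b0 + 2 * b k) * (X * d0 + 2 * d k)))"
    unfolding ls lt by (simp add: sum_distrib_left power2_eq_square algebra_simps)
  also have "\<dots> = 16 * slope c \<alpha> p s t"
    unfolding sum_square_affine_product sl using b d X_def by algebra
  finally show ?thesis .
qed

lemma gradient_radial:
  assumes "level c \<alpha> p s = 0"
  shows "(\<Sum>k\<in>UNIV. 2 * p$k * level_deriv c \<alpha> k p s) = 4 * (p \<bullet> p - 1) * (p \<bullet> p + 1) / (s - c)"
proof -
  define X where "X = p \<bullet> p - 1"
  define b0 where "b0 = 1 / (s - c)"
  define b where "b k = 1 / (s - \<alpha> k)" for k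
  have b: "4 * (\<Sum>k\<in>UNIV. (p$k)\<^sup>2 * b k) = - (X\<^sup>2 * b0)"
    unfolding b_def b0_def X_def by (rule level_root_eq[OF assms(1)])
  have ls: "level_deriv c \<alpha> k p s = 4 * (p$k * (X * b0 + 2 * b k))" for k
    by (simp add: level_deriv_def X_def b0_def b_def)
  have "(\<Sum>k\<in>UNIV. 2 * p$k * level_deriv c \<alpha> k p s) =
      8 * (X * b0 * (p \<bullet> p) + 2 * (\<Sum>k\<in>UNIV. (p$k)\<^sup>2 * b k))"
    unfolding ls
    by (simp add: sum_distrib_left power2_eq_square inner_vec_def algebra_simps sum.distrib)
  also have "\<dots> = 4 * X * (p \<bullet> p + 1) * b0"
    using b X_def by algebra
  finally show ?thesis
    by (simp add: X_def b0_def)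
qed

text \<open>This sum is the contraction of the gradient of \<open>level\<close> with that of its derivative in \<open>s\<close>, up
  to a constant. It produces the third moment, which then cancels in the Laplacian of the root.\<close>

lemma gradient_second_moment:
  assumes "level c \<alpha> p s = 0"
  shows "(\<Sum>k\<in>UNIV. level_deriv c \<alpha> k p s *
      (p$k * ((p \<bullet> p - 1) / (s - c)\<^sup>2 + 2 / (s - \<alpha> k)\<^sup>2))) =
    4 * cubic_moment c \<alpha> p s + 2 * (p \<bullet> p - 1) / (s - c) * slope c \<alpha> p s s"
proof -
  define X where "X = p \<bullet> p - 1"
  define b0 where "b0 = 1 / (s - c)"
  define b where "b k = 1 / (s - \<alpha> k)" for k
  have b: "4 * (\<Sum>k\<in>UNIV. (p$k)\<^sup>2 * b k) = - (X\<^sup>2 * b0)"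
    unfolding b_def b0_def X_def by (rule level_root_eq[OF assms(1)])
  have ls: "level_deriv c \<alpha> k p s = 4 * (p$k * (X * b0 + 2 * b k))" for k
    by (simp add: level_deriv_def X_def b0_def b_def)
  have B: "(p \<bullet> p - 1) / (s - c)\<^sup>2 + 2 / (s - \<alpha> k)\<^sup>2 = X * b0\<^sup>2 + 2 * (b k)\<^sup>2" for k
    by (simp add: X_def b0_def b_def power_divide)
  have sl: "slope c \<alpha> p s s = X\<^sup>2 * b0\<^sup>2 + 4 * (\<Sum>k\<in>UNIV. (p$k)\<^sup>2 * (b k)\<^sup>2)"
    by (simp add: slope_def X_def b0_def b_def sum_distrib_left mult.assoc power2_eq_square)
  have M: "cubic_moment c \<alpha> p s = X\<^sup>2 * b0^3 + 4 * (\<Sum>k\<in>UNIV. (p$k)\<^sup>2 * (b k * (b k)\<^sup>2))"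
    by (simp add: cubic_moment_def X_def b0_def b_def sum_distrib_left mult.assoc power2_eq_square power3_eq_cube)
  have "(\<Sum>k\<in>UNIV. level_deriv c \<alpha> k p s *
      (p$k * ((p \<bullet> p - 1) / (s - c)\<^sup>2 + 2 / (s - \<alpha> k)\<^sup>2))) =
      4 * (\<Sum>k\<in>UNIV. (p$k)\<^sup>2 * ((X * b0 + 2 * b k) * (X * b0\<^sup>2 + 2 * (b k)\<^sup>2)))"
    unfolding ls B by (simp add: sum_distrib_left power2_eq_square algebra_simps)
  also have "\<dots> = 4 * cubic_moment c \<alpha> p s + 2 * X * b0 * slope c \<alpha> p s s"
    unfolding sum_square_affine_product sl M using b X_def by algebra
  finally show ?thesis
    by (simp add: X_def b0_def)
qed

context cyclide_root
begin

lemma gradient_norm: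
  assumes "p \<in> S"
  shows "(\<Sum>k\<in>UNIV. grad k p * grad k p) = 16 / N p"
proof -
  have "(\<Sum>k\<in>UNIV. grad k p * grad k p) = (\<Sum>k\<in>UNIV. grad_num k p * grad_num k p) / (N p)\<^sup>2"
    by (simp add: grad_def sum_divide_distrib power2_eq_square)
  also have "\<dots> = 16 / N p"
    using gradient_inner_product[OF root root, OF assms assms] N_nz[OF assms]
    by (simp add: grad_num_def N_def power2_eq_square)
  finally show ?thesis .
qed

lemma gradient_dot_radial:
  assumes "p \<in> S"
  shows "(\<Sum>k\<in>UNIV. 2 * p$k * grad k p) = 4 * (p \<bullet> p - 1) * (p \<bullet> p + 1) / (s p - c) / N p"
  using gradient_radial[OF root[OF assms]]
  by (simp add: grad_def grad_num_def sum_divide_distrib[symmetric])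

text \<open>In dimension three, the term that is not a multiple of the sum of reciprocals equals
  \<open>(\<nabla>R / R) \<bullet> \<nabla>s\<close> with \<open>R = p \<bullet> p + 1\<close>, see \<open>gradient_dot_radial\<close>; the conformal Laplacian removes it.\<close>

lemma laplacian_root:
  assumes p: "p \<in> S"
  shows "(\<Sum>k\<in>UNIV. hess k k p) =
    (8 * (1 / (s p - c) + (\<Sum>k\<in>UNIV. 1 / (s p - \<alpha> k)))
      + (4 * real CARD('n) - 8) * (p \<bullet> p - 1) / (s p - c)) / N p"
proof -
  define X where "X = p \<bullet> p - 1"
  define b0 where "b0 = 1 / (s p - c)"
  define b where "b k = 1 / (s p - \<alpha> k)" for k
  define M where "M = cubic_moment c \<alpha> p (s p)"
  define B where "B k = X * b0\<^sup>2 + 2 * (b k)\<^sup>2" for k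
  have nz: "N p \<noteq> 0"
    by (rule N_nz[OF p])
  have "N p * hess k k p = 4 * (X * b0 + 2 * b k) + 8 * b0 * (p$k)\<^sup>2
      - 8 / N p * (grad_num k p * (p$k * B k)) + 2 * M * (grad k p * grad k p)" for k
  proof -
    have "N p * hess k k p = grad_num_deriv k k p - grad k p * N_deriv k p"
      using nz by (simp add: hess_def grad_def power2_eq_square field_simps)
    moreover have "grad_num_deriv k k p = 4 * (X * b0 + 2 * b k) + 4 * p$k * (2 * p$k * b0 - B k * grad k p)"
      by (simp add: grad_num_deriv_def X_def b0_def b_def B_def power_divide)
    moreover have "N_deriv k p = 4 * p$k * B k - 2 * M * grad k p"
      by (simp add: N_deriv_def X_def b0_def b_def B_def M_def power_divide)
    moreover have "grad_num k p = grad k p * N p"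
      using nz by (simp add: grad_def)
    ultimately show ?thesis
      using nz by (simp add: algebra_simps power2_eq_square)
  qed
  then have "N p * (\<Sum>k\<in>UNIV. hess k k p) =
      (\<Sum>k\<in>UNIV. 4 * (X * b0 + 2 * b k) + 8 * b0 * (p$k)\<^sup>2
      - 8 / N p * (grad_num k p * (p$k * B k)) + 2 * M * (grad k p * grad k p))"
    by (simp add: sum_distrib_left)
  also have "\<dots> = 4 * real CARD('n) * X * b0 + 8 * (\<Sum>k\<in>UNIV. b k) + 8 * b0 * (p \<bullet> p)
      - 8 / N p * (\<Sum>k\<in>UNIV. grad_num k p * (p$k * B k)) + 2 * M * (\<Sum>k\<in>UNIV. grad k p * grad k p)"
    by (simp add: sum.distrib sum_subtractf sum_distrib_left sum_distrib_right inner_vec_def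
        power2_eq_square algebra_simps)
  also have "(\<Sum>k\<in>UNIV. grad_num k p * (p$k * B k)) = 4 * M + 2 * X * b0 * N p"
    using gradient_second_moment[OF root[OF p]]
    by (simp add: grad_num_def B_def X_def b0_def b_def M_def N_def power_divide)
  also have "(\<Sum>k\<in>UNIV. grad k p * grad k p) = 16 / N p"
    by (rule gradient_norm[OF p])
  also have "4 * real CARD('n) * X * b0 + 8 * (\<Sum>k\<in>UNIV. b k) + 8 * b0 * (p \<bullet> p)
      - 8 / N p * (4 * M + 2 * X * b0 * N p) + 2 * M * (16 / N p) =
     4 * real CARD('n) * X * b0 + 8 * (\<Sum>k\<in>UNIV. b k) + 8 * b0 * (X + 1) - 16 * X * b0"
    using nz by (simp add: field_simps X_def)
  also have "\<dots> = 8 * (b0 + (\<Sum>k\<in>UNIV. b k)) + (4 * real CARD('n) - 8) * X * b0"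
    by (simp add: algebra_simps)
  finally show ?thesis
    using nz by (simp add: field_simps X_def b0_def b_def)
qed

end

text \<open>For two different roots at the same point the divided difference of \<open>level\<close> is zero.\<close>

lemma gradients_orthogonal:
  assumes "cyclide_root S l r c \<alpha> s" "cyclide_root S l' r' c \<alpha> t" "p \<in> S" "s p \<noteq> t p"
  shows "(\<Sum>k\<in>UNIV. cyclide_root.grad c \<alpha> s k p * cyclide_root.grad c \<alpha> t k p) = 0"
proof -
  interpret s: cyclide_root S l r c \<alpha> s by fact
  interpret t: cyclide_root S l' r' c \<alpha> t by fact
  have "(t p - s p) * slope c \<alpha> p (s p) (t p) = 0"
    using level_diff[of "s p" c "t p" \<alpha> p] s.root t.root s.pole t.pole s.pole0 t.pole0 assms(3)
    by simp
  then have "(\<Sum>k\<in>UNIV. s.grad_num k p * t.grad_num k p) = 0"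
    using gradient_inner_product[OF s.root t.root, OF assms(3) assms(3)] assms(4)
    by (simp add: s.grad_num_def t.grad_num_def)
  then show ?thesis
    by (simp add: s.grad_def t.grad_def sum_divide_distrib[symmetric])
qed

section \<open>The three roots in dimension three\<close>

definition pole_of :: "(nat \<Rightarrow> real) \<Rightarrow> 3 \<Rightarrow> real" where
  "pole_of a j = (if j = 1 then a 1 else if j = 2 then a 2 else a 3)"

lemma pole_of_simps [simp]: "pole_of a 1 = a 1" "pole_of a 2 = a 2" "pole_of a 3 = a 3"
  by (simp_all add: pole_of_def)

lemma inner_self_3: "p \<bullet> p = (p$1)\<^sup>2 + (p$2)\<^sup>2 + (p$3)\<^sup>2" for p :: "real^3"
  by (simp add: inner_vec_def sum_3 power2_eq_square)

lemma cyclide_fun_eq_level: "cyclide_fun a p s = level (a 0) (pole_of a) p s"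
  by (simp add: cyclide_fun_def level_def sum_3 inner_self_3)

text \<open>Taking divided differences twice expresses the coefficients through the roots.\<close>

lemma cubic_factorisation:
  fixes r1 r2 r3 :: real
  assumes "\<And>s. f s = c3 * s^3 + c2 * s\<^sup>2 + c1 * s + c0"
    and "f r1 = 0" "f r2 = 0" "f r3 = 0" and "r1 \<noteq> r2" "r1 \<noteq> r3" "r2 \<noteq> r3"
  shows "f s = c3 * ((s - r1) * (s - r2) * (s - r3))"
proof -
  have "(r1 - r2) * (c3 * (r1\<^sup>2 + r1 * r2 + r2\<^sup>2) + c2 * (r1 + r2) + c1) = f r1 - f r2"
    "(r1 - r3) * (c3 * (r1\<^sup>2 + r1 * r3 + r3\<^sup>2) + c2 * (r1 + r3) + c1) = f r1 - f r3"
    unfolding assms(1) by algebra+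
  then have 2: "c3 * (r1\<^sup>2 + r1 * r2 + r2\<^sup>2) + c2 * (r1 + r2) + c1 = 0"
    and 3: "c3 * (r1\<^sup>2 + r1 * r3 + r3\<^sup>2) + c2 * (r1 + r3) + c1 = 0"
    using assms(2-7) by simp_all
  have "(r2 - r3) * (c3 * (r1 + r2 + r3) + c2) = 0"
    using 2 3 by algebra
  then have 1: "c3 * (r1 + r2 + r3) + c2 = 0"
    using assms by simp
  have 0: "c3 * r1^3 + c2 * r1\<^sup>2 + c1 * r1 + c0 = 0"
    using assms by metis
  show ?thesis
    unfolding assms(1) using 0 1 2 by algebra
qed

text \<open>The equation for \<open>s\<close> with its denominators cleared.\<close>

definition level_cubic :: "(nat \<Rightarrow> real) \<Rightarrow> real^3 \<Rightarrow> real \<Rightarrow> real" where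
  "level_cubic a p s =
     (p \<bullet> p - 1)\<^sup>2 * ((s - a 1) * (s - a 2) * (s - a 3)) +
     4 * (p$1)\<^sup>2 * ((s - a 0) * (s - a 2) * (s - a 3)) +
     4 * (p$2)\<^sup>2 * ((s - a 0) * (s - a 1) * (s - a 3)) +
     4 * (p$3)\<^sup>2 * ((s - a 0) * (s - a 1) * (s - a 2))"

lemma prod_atMost_3: "(\<Prod>j\<le>3::nat. f j) = f 0 * f 1 * f 2 * f 3"
  for f :: "nat \<Rightarrow> 'b::comm_monoid_mult"
  by (simp add: numeral_3_eq_3 numeral_2_eq_2)

lemma sum_atMost_3: "(\<Sum>j\<le>3::nat. f j) = f 0 + f 1 + f 2 + f 3"
  for f :: "nat \<Rightarrow> 'b::comm_monoid_add"
  by (simp add: numeral_3_eq_3 numeral_2_eq_2)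

lemma level_cubic_eq:
  assumes "s \<notin> a ` {..3}"
  shows "level_cubic a p s = cyclide_fun a p s * (\<Prod>j\<le>3. s - a j)"
proof -
  have "s \<noteq> a 0" "s \<noteq> a 1" "s \<noteq> a 2" "s \<noteq> a 3"
    using assms by auto
  then show ?thesis
    by (simp add: level_cubic_def cyclide_fun_def prod_atMost_3 inner_self_3 distrib_right)
qed

definition separated :: "(nat \<Rightarrow> real) \<Rightarrow> real \<Rightarrow> real \<Rightarrow> real \<Rightarrow> bool" where
  "separated a s1 s2 s3 \<longleftrightarrow> a 0 < s1 \<and> s1 < a 1 \<and> a 1 < s2 \<and> s2 < a 2 \<and> a 2 < s3 \<and> s3 < a 3"

lemma separated_not_pole:
  assumes "separated a s1 s2 s3" "s \<in> {s1, s2, s3}"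
  shows "s \<notin> a ` {..3}"
proof -
  have "{..3} = {0, 1, 2, 3::nat}"
    by auto
  then show ?thesis
    using assms by (auto simp: separated_def)
qed

text \<open>The leading coefficient is \<open>(|p|\<^sup>2 - 1)\<^sup>2 + 4 |p|\<^sup>2\<close>, which is a square.\<close>

lemma level_cubic_factorisation:
  assumes "separated a s1 s2 s3" "\<And>s. s \<in> {s1, s2, s3} \<Longrightarrow> cyclide_fun a p s = 0"
  shows "level_cubic a p s = (p \<bullet> p + 1)\<^sup>2 * ((s - s1) * (s - s2) * (s - s3))"
proof (rule cubic_factorisation)
  let ?c = "\<lambda>f. (p \<bullet> p - 1)\<^sup>2 * f (a 1) (a 2) (a 3) + 4 * (p$1)\<^sup>2 * f (a 0) (a 2) (a 3) +
    4 * (p$2)\<^sup>2 * f (a 0) (a 1) (a 3) + 4 * (p$3)\<^sup>2 * f (a 0) (a 1) (a 2)"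
  have R: "(p \<bullet> p + 1)\<^sup>2 = (p \<bullet> p - 1)\<^sup>2 + 4 * (p$1)\<^sup>2 + 4 * (p$2)\<^sup>2 + 4 * (p$3)\<^sup>2"
    unfolding inner_self_3 by algebra
  show "level_cubic a p s = (p \<bullet> p + 1)\<^sup>2 * s^3 + ?c (\<lambda>x y z. - (x + y + z)) * s\<^sup>2 +
     ?c (\<lambda>x y z. x * y + x * z + y * z) * s + ?c (\<lambda>x y z. - (x * y * z))" for s
    unfolding R level_cubic_def by algebra
  show "level_cubic a p s1 = 0" "level_cubic a p s2 = 0" "level_cubic a p s3 = 0"
    using assms separated_not_pole[OF assms(1)] by (simp_all add: level_cubic_eq)
  show "s1 \<noteq> s2" "s1 \<noteq> s3" "s2 \<noteq> s3"
    using assms(1) by (auto simp: separated_def)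
qed

lemma cyclide_fun_zeros:
  assumes "separated a s1 s2 s3" "\<And>s. s \<in> {s1, s2, s3} \<Longrightarrow> cyclide_fun a p s = 0"
  shows "{s. s \<notin> a ` {..3} \<and> cyclide_fun a p s = 0} = {s1, s2, s3}"
proof -
  have "p \<bullet> p + 1 \<noteq> 0"
    using inner_ge_zero[of p] by linarith
  then have "s \<in> {s1, s2, s3}" if "s \<notin> a ` {..3}" "cyclide_fun a p s = 0" for s
    using level_cubic_eq[OF that(1), of p] that(2) level_cubic_factorisation[OF assms, of s] by auto
  then show ?thesis
    using assms separated_not_pole[OF assms(1)] by blast
qed

lemma cyclide_coords_eqI:
  assumes "separated a s1 s2 s3" "\<And>s. s \<in> {s1, s2, s3} \<Longrightarrow> cyclide_fun a p s = 0"
  shows "cyclide_coords a p = (s1, s2, s3)"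
  unfolding cyclide_coords_def
proof (rule the_equality)
  show "case (s1, s2, s3) of (s1, s2, s3) \<Rightarrow>
     a 0 < s1 \<and> s1 < a 1 \<and> a 1 < s2 \<and> s2 < a 2 \<and> a 2 < s3 \<and> s3 < a 3 \<and>
     {s. s \<notin> a ` {..3} \<and> cyclide_fun a p s = 0} = {s1, s2, s3}"
    using cyclide_fun_zeros[OF assms] assms(1) by (simp add: separated_def)
next
  fix t
  assume t: "case t of (s1, s2, s3) \<Rightarrow>
     a 0 < s1 \<and> s1 < a 1 \<and> a 1 < s2 \<and> s2 < a 2 \<and> a 2 < s3 \<and> s3 < a 3 \<and>
     {s. s \<notin> a ` {..3} \<and> cyclide_fun a p s = 0} = {s1, s2, s3}"
  obtain t1 t2 t3 where "t = (t1, t2, t3)"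
    by (cases t)
  with t have ord: "a 0 < t1" "t1 < a 1" "a 1 < t2" "t2 < a 2" "a 2 < t3" "t3 < a 3"
    and eq: "{t1, t2, t3} = {s1, s2, s3}"
    using cyclide_fun_zeros[OF assms] by auto
  have sep: "a 0 < s1" "s1 < a 1" "a 1 < s2" "s2 < a 2" "a 2 < s3" "s3 < a 3"
    using assms(1) by (simp_all add: separated_def)
  have "t1 = s1 \<or> t1 = s2 \<or> t1 = s3" "t2 = s1 \<or> t2 = s2 \<or> t2 = s3" "t3 = s1 \<or> t3 = s2 \<or> t3 = s3"
    using eq by blast+
  then have "t1 = s1" "t2 = s2" "t3 = s3"
    using ord sep by linarith+
  then show "t = (s1, s2, s3)"
    using \<open>t = (t1, t2, t3)\<close> by simp
qed

text \<open>At a pole only one term of \<open>level_cubic\<close> survives. On the region its coefficient is positive, so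
  the signs at the four poles alternate.\<close>

lemma cyclide_roots_exist:
  assumes "a 0 < a 1" "a 1 < a 2" "a 2 < a 3" "p \<in> T_region"
  obtains s1 s2 s3 where "separated a s1 s2 s3"
    "\<And>s. s \<in> {s1, s2, s3} \<Longrightarrow> cyclide_fun a p s = 0"
proof -
  have X: "(p \<bullet> p - 1)\<^sup>2 > 0" "(p$1)\<^sup>2 > 0" "(p$2)\<^sup>2 > 0" "(p$3)\<^sup>2 > 0"
    using assms(4) by (auto simp: T_region_def inner_self_3)
  have cont: "continuous_on {x..y} (level_cubic a p)" for x y
    unfolding level_cubic_def by (intro continuous_intros)
  have sgn: "level_cubic a p (a 0) < 0" "level_cubic a p (a 1) > 0"
    "level_cubic a p (a 2) < 0" "level_cubic a p (a 3) > 0"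
    using X assms(1-3)
    by (simp_all add: level_cubic_def zero_less_mult_iff mult_less_0_iff)
  have "\<exists>s>a 0. s < a 1 \<and> level_cubic a p s = 0"
    using IVT'[OF less_imp_le[OF sgn(1)] less_imp_le[OF sgn(2)] less_imp_le[OF assms(1)] cont] sgn
    by (metis order_le_less less_irrefl)
  moreover have "\<exists>s>a 1. s < a 2 \<and> level_cubic a p s = 0"
    using IVT2'[OF less_imp_le[OF sgn(3)] less_imp_le[OF sgn(2)] less_imp_le[OF assms(2)] cont] sgn
    by (metis order_le_less less_irrefl)
  moreover have "\<exists>s>a 2. s < a 3 \<and> level_cubic a p s = 0"
    using IVT'[OF less_imp_le[OF sgn(3)] less_imp_le[OF sgn(4)] less_imp_le[OF assms(3)] cont] sgn
    by (metis order_le_less less_irrefl)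
  ultimately obtain s1 s2 s3 where sep: "separated a s1 s2 s3"
    and zero: "\<And>s. s \<in> {s1, s2, s3} \<Longrightarrow> level_cubic a p s = 0"
    unfolding separated_def by blast
  have "cyclide_fun a p s = 0" if "s \<in> {s1, s2, s3}" for s
    using zero[OF that] level_cubic_eq[OF separated_not_pole[OF sep that]]
      separated_not_pole[OF sep that] by auto
  with sep show thesis
    using that by blast
qed

text \<open>Both sides are continuous in their first argument \<open>t\<close>, and away from the root they are the
  cubic divided by its linear factor, computed from the divided difference and from the factorisation.\<close>

lemma slope_at_root:
  assumes "separated a s1 s2 s3" "\<And>s. s \<in> {s1, s2, s3} \<Longrightarrow> cyclide_fun a p s = 0"
    and "{s1, s2, s3} = {t, t', t''}" "t \<noteq> t'" "t \<noteq> t''" "t' \<noteq> t''"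
  shows "slope (a 0) (pole_of a) p t t * (\<Prod>j\<le>3. t - a j) = - (p \<bullet> p + 1)\<^sup>2 * ((t - t') * (t - t''))"
proof -
  have tS: "t \<in> {s1, s2, s3}"
    using assms(3) by simp
  have np: "t \<notin> a ` {..3}"
    using separated_not_pole[OF assms(1) tS] .
  let ?P = "\<lambda>x. \<Prod>j\<le>3. x - a j"
  let ?f = "\<lambda>x. slope (a 0) (pole_of a) p x t * ?P x"
  let ?g = "\<lambda>x. - (p \<bullet> p + 1)\<^sup>2 * ((x - t') * (x - t''))"
  have np': "t \<noteq> a 0" "t \<noteq> a 1" "t \<noteq> a 2" "t \<noteq> a 3"
    using np by auto
  have "isCont ?f t"
    unfolding slope_def prod_atMost_3 sum_3 using np' by (auto intro!: continuous_intros)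
  moreover have "isCont ?g t"
    by (intro continuous_intros)
  moreover have "\<forall>\<^sub>F x in at t. ?f x = ?g x"
  proof -
    have "open (- (a ` {..3}))"
      by (intro open_Compl finite_imp_closed) simp
    then have "\<forall>\<^sub>F x in at t. x \<notin> a ` {..3}"
      using np by (auto simp: eventually_at_topological)
    moreover have "\<forall>\<^sub>F x in at t. x \<noteq> t"
      by (simp add: eventually_at_filter)
    ultimately show ?thesis
    proof eventually_elim
      case (elim x)
      have npx: "x \<noteq> a 0" "x \<noteq> a 1" "x \<noteq> a 2" "x \<noteq> a 3"
        using elim by auto
      have "(s - s1) * (s - s2) * (s - s3) = (s - t) * (s - t') * (s - t'')" for s
      proof -
        have "(\<Prod>r\<in>{s1, s2, s3}. s - r) = (s - s1) * (s - s2) * (s - s3)"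
          using assms(1) by (auto simp: separated_def)
        moreover have "(\<Prod>r\<in>{t, t', t''}. s - r) = (s - t) * (s - t') * (s - t'')"
          using assms(4-6) by auto
        ultimately show ?thesis
          unfolding assms(3) by simp
      qed
      then have "cyclide_fun a p x * ?P x = (p \<bullet> p + 1)\<^sup>2 * ((x - t) * (x - t') * (x - t''))"
        using level_cubic_eq[OF elim(1)] level_cubic_factorisation[OF assms(1,2)] by metis
      moreover have "cyclide_fun a p x = (t - x) * slope (a 0) (pole_of a) p x t"
        using level_diff[of x "a 0" t "pole_of a" p] assms(2)[OF tS] np' npx
        by (simp add: cyclide_fun_eq_level pole_of_def)
      ultimately have "(x - t) * (?f x - ?g x) = 0"
        by algebra
      then show ?case
        using elim(2) by simp
    qed
  qed
  ultimately have "?f \<midarrow>t\<rightarrow> ?f t" "?f \<midarrow>t\<rightarrow> ?g t"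
    using tendsto_cong[of ?f ?g "at t"] unfolding continuous_at by blast+
  then show ?thesis
    by (rule LIM_unique)
qed

text \<open>The leading coefficient of a quadratic polynomial, recovered from its values at three points.\<close>

lemma cyclide_lagrange:
  fixes s1 s2 s3 q0 q1 q2 :: complex
  assumes "s1 \<noteq> s2" "s1 \<noteq> s3" "s2 \<noteq> s3"
  shows "(q2 * s1\<^sup>2 + q1 * s1 + q0) / ((s1 - s2) * (s1 - s3)) +
    (q2 * s2\<^sup>2 + q1 * s2 + q0) / ((s2 - s1) * (s2 - s3)) +
    (q2 * s3\<^sup>2 + q1 * s3 + q0) / ((s3 - s1) * (s3 - s2)) = q2"
proof -
  \<comment> \<open>With the differences of the nodes as variables, the denominators are products of variables.\<close>
  define u v where "u = s1 - s2" and "v = s2 - s3"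
  have e: "s1 = s3 + v + u" "s2 = s3 + v"
    by (simp_all add: u_def v_def)
  have "u \<noteq> 0" "v \<noteq> 0" "u + v \<noteq> 0"
    using assms by (auto simp: u_def v_def)
  then show ?thesis
    unfolding e by (simp add: divide_simps) algebra
qed

section \<open>The conformal Laplacian\<close>

text \<open>The operator \<open>\<Delta> - (\<nabla>R / R) \<bullet> \<nabla>\<close> with \<open>R = |p|\<^sup>2 + 1\<close>, applied to a function with partial
  derivatives \<open>g\<close> and \<open>h\<close>. In dimension three it is \<open>4 / R\<^sup>2\<close> times the Laplace-Beltrami operator
  of the unit sphere in stereographic coordinates.\<close>

definition conformal_laplacian ::
  "('n \<Rightarrow> real^'n \<Rightarrow> 'b) \<Rightarrow> ('n \<Rightarrow> 'n \<Rightarrow> real^'n::finite \<Rightarrow> 'b) \<Rightarrow> real^'n \<Rightarrow> 'b::real_normed_vector" where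
  "conformal_laplacian g h p =
     (\<Sum>k\<in>UNIV. h k k p) - (\<Sum>k\<in>UNIV. (2 * p$k / (p \<bullet> p + 1)) *\<^sub>R g k p)"

text \<open>The first-order part is a derivation anyway, and the cross term of the Laplacian is the inner
  product of the gradients.\<close>

lemma conformal_laplacian_mult:
  fixes u v :: "real^'n::finite \<Rightarrow> 'b::{real_normed_algebra, comm_ring}"
  assumes "(\<Sum>k\<in>UNIV. g k p * g' k p) = 0"
  shows "conformal_laplacian (\<lambda>k p. u p * g' k p + g k p * v p)
      (\<lambda>k l p. (u p * h' k l p + g l p * g' k p) + (g k p * g' l p + h k l p * v p)) p =
    u p * conformal_laplacian g' h' p + conformal_laplacian g h p * v p"
  using assms
  by (simp add: conformal_laplacian_def sum.distrib sum_distrib_left sum_distrib_right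
      scaleR_add_right algebra_simps)

definition weight :: "real^'n::finite \<Rightarrow> complex" where
  "weight p = of_real ((p \<bullet> p + 1) powr (-1/2))"

definition weight_grad :: "'n \<Rightarrow> real^'n::finite \<Rightarrow> complex" where
  "weight_grad k p = - (of_real (p$k / (p \<bullet> p + 1)) * weight p)"

lemma C2_norm_square:
  "C2_with S (\<lambda>p. p \<bullet> p + 1) (\<lambda>k p. 2 * p$k) (\<lambda>k l p. if k = l then 2 else 0)"
  for S :: "(real^'n::finite) set"
  unfolding C2_with_def C1_with_def has_partial_deriv_real line_norm_square line_component
  by (auto intro!: continuous_intros derivative_eq_intros)

lemma weight_jet:
  fixes S :: "(real^'n::finite) set"
  obtains h where "C2_with S weight weight_grad h"
    "CARD('n) = 3 \<Longrightarrow> (\<And>p. (\<Sum>k\<in>UNIV. h k k p) = - (3 / of_real ((p \<bullet> p + 1)\<^sup>2)) * weight p)"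
proof -
  have pos: "p \<bullet> p + 1 > 0" for p :: "real^'n"
    using inner_ge_zero[of p] by linarith
  define w where "w r = complex_of_real (r powr (-1/2))" for r
  define w' where "w' r = complex_of_real (- (r powr (-1/2) / (2 * r)))" for r
  define w'' where "w'' r = complex_of_real (3 / 4 * (r powr (-1/2) / r\<^sup>2))" for r
  define h where "h = (\<lambda>k l (p::real^'n). (2 * p$k) *\<^sub>R ((2 * p$l) *\<^sub>R w'' (p \<bullet> p + 1)) +
     (if k = l then 2 else 0) *\<^sub>R w' (p \<bullet> p + 1))"
  have D: "((\<lambda>r. r powr (-1/2)) has_real_derivative - (r powr (-1/2) / (2 * r))) (at r)" if "r > 0" for r :: real
  proof -
    have "r powr (-1/2 - 1) = r powr (-1/2) / r"
      using that by (subst powr_diff) simp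
    then show ?thesis
      using that by (intro DERIV_cong[OF has_real_derivative_powr]) auto
  qed
  have 1: "(w has_vector_derivative w' r) (at r)" if "r \<in> {0<..}" for r
    unfolding w_def w'_def
    by (rule has_vector_derivative_of_real)
      (use D that in auto)
  have D': "((\<lambda>r. - (r powr (-1/2) / (2 * r))) has_real_derivative 3 / 4 * (r powr (-1/2) / r\<^sup>2)) (at r)"
    if "r > 0" for r :: real
    by (rule DERIV_cong[OF DERIV_minus[OF DERIV_divide[OF D[OF that] DERIV_cmult[OF DERIV_ident]]]])
      (use that in \<open>simp_all add: field_simps power2_eq_square\<close>)
  have 2: "(w' has_vector_derivative w'' r) (at r)" if "r \<in> {0<..}" for r
    unfolding w''_def w'_def
    by (rule has_vector_derivative_of_real)
      (use D' that in auto)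
  have "continuous_on {0<..} w''"
    unfolding w''_def by (auto intro!: continuous_intros)
  then have "C2_with S (\<lambda>p. w (p \<bullet> p + 1)) (\<lambda>k p. (2 * p$k) *\<^sub>R w' (p \<bullet> p + 1)) h"
    unfolding h_def using pos by (intro C2_with_compose[OF C2_norm_square _ 1 2]) auto
  moreover have "(\<lambda>k (p::real^'n). (2 * p$k) *\<^sub>R w' (p \<bullet> p + 1)) = weight_grad"
  proof (intro ext)
    fix k and p :: "real^'n"
    have alg: "(2 * x) * - (z / (2 * r)) = - (x / r * z)" for x z r :: real
      by simp
    show "(2 * p$k) *\<^sub>R w' (p \<bullet> p + 1) = weight_grad k p"
      unfolding w'_def scaleR_conv_of_real of_real_mult[symmetric] alg weight_grad_def weight_def
      by (simp only: of_real_minus of_real_mult)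
  qed
  ultimately have "C2_with S weight weight_grad h"
    by (simp add: w_def weight_def[abs_def])
  moreover have "(\<Sum>k\<in>UNIV. h k k p) = - (3 / of_real ((p \<bullet> p + 1)\<^sup>2)) * weight p"
    if n: "CARD('n) = 3" for p
  proof -
    let ?R = "p \<bullet> p + 1"
    have "(\<Sum>k\<in>UNIV. h k k p) = (4 * (\<Sum>k\<in>UNIV. p$k * p$k)) *\<^sub>R w'' ?R + 6 *\<^sub>R w' ?R"
      using n by (simp add: h_def sum.distrib scaleR_sum_left sum_distrib_left mult_ac)
    also have "(\<Sum>k\<in>UNIV. p$k * p$k) = ?R - 1"
      by (simp add: inner_vec_def)
    also have "(4 * (?R - 1)) *\<^sub>R w'' ?R + 6 *\<^sub>R w' ?R =
        of_real (4 * (?R - 1) * (3 / 4 * (?R powr (-1/2) / ?R\<^sup>2)) - 6 * (?R powr (-1/2) / (2 * ?R)))"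
      by (simp add: w'_def w''_def scaleR_conv_of_real)
    also have "4 * (?R - 1) * (3 / 4 * (?R powr (-1/2) / ?R\<^sup>2)) - 6 * (?R powr (-1/2) / (2 * ?R)) =
        - (3 / ?R\<^sup>2) * (?R powr (-1/2))"
    proof -
      have alg: "4 * (r - 1) * (3 / 4 * (z / r\<^sup>2)) - 6 * (z / (2 * r)) = - (3 / r\<^sup>2) * z"
        if "r \<noteq> 0" for r z :: real
        using that by (simp add: field_simps power2_eq_square)
      show ?thesis
        using pos[of p] by (intro alg) simp
    qed
    finally show ?thesis
      by (simp add: weight_def)
  qed
  ultimately show thesis
    using that by blast
qed

text \<open>The gradient of the weight is \<open>- \<nabla>R / (2 R)\<close> times the weight, so the cross term of the product
  rule is exactly the first-order part of the conformal Laplacian.\<close>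

lemma laplacian_weight_mult:
  fixes u :: "real^'n::finite \<Rightarrow> complex"
  assumes "(\<Sum>k\<in>UNIV. h k k p) = - (3 / of_real ((p \<bullet> p + 1)\<^sup>2)) * weight p"
  shows "(\<Sum>k\<in>UNIV. (weight p * h' k k p + weight_grad k p * g' k p) +
      (weight_grad k p * g' k p + h k k p * u p)) =
    weight p * (conformal_laplacian g' h' p - 3 / of_real ((p \<bullet> p + 1)\<^sup>2) * u p)"
proof -
  have "(\<Sum>k\<in>UNIV. weight_grad k p * g' k p) + (\<Sum>k\<in>UNIV. weight_grad k p * g' k p) =
     - (weight p * (\<Sum>k\<in>UNIV. (2 * p$k / (p \<bullet> p + 1)) *\<^sub>R g' k p))"
    by (simp add: weight_grad_def sum_distrib_left sum_negf[symmetric] scaleR_conv_of_real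
        sum.distrib[symmetric] algebra_simps)
  then have "(\<Sum>k\<in>UNIV. (weight p * h' k k p + weight_grad k p * g' k p) +
      (weight_grad k p * g' k p + h k k p * u p)) =
    weight p * (\<Sum>k\<in>UNIV. h' k k p) + (\<Sum>k\<in>UNIV. h k k p) * u p
      - (weight p * (\<Sum>k\<in>UNIV. (2 * p$k / (p \<bullet> p + 1)) *\<^sub>R g' k p))"
    by (simp add: sum.distrib sum_distrib_left sum_distrib_right)
  then show ?thesis
    unfolding assms by (simp add: conformal_laplacian_def algebra_simps)
qed

context cyclide_root
begin

lemma conformal_laplacian_compose:
  fixes w' w'' :: "real \<Rightarrow> 'b::real_normed_vector"
  assumes p: "p \<in> S" and n: "CARD('n) = 3"
  shows "conformal_laplacian (\<lambda>k p. grad k p *\<^sub>R w' (s p))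
      (\<lambda>k l p. grad k p *\<^sub>R (grad l p *\<^sub>R w'' (s p)) + hess k l p *\<^sub>R w' (s p)) p =
    (16 / N p) *\<^sub>R (w'' (s p) + (1/2 * (1 / (s p - c) + (\<Sum>k\<in>UNIV. 1 / (s p - \<alpha> k)))) *\<^sub>R w' (s p))"
proof -
  let ?A = "1 / (s p - c) + (\<Sum>k\<in>UNIV. 1 / (s p - \<alpha> k))"
  let ?X = "p \<bullet> p - 1" and ?R = "p \<bullet> p + 1"
  have R: "?R \<noteq> 0"
    using inner_ge_zero[of p] by linarith
  have "conformal_laplacian (\<lambda>k p. grad k p *\<^sub>R w' (s p))
      (\<lambda>k l p. grad k p *\<^sub>R (grad l p *\<^sub>R w'' (s p)) + hess k l p *\<^sub>R w' (s p)) p =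
    (\<Sum>k\<in>UNIV. grad k p * grad k p) *\<^sub>R w'' (s p) + (\<Sum>k\<in>UNIV. hess k k p) *\<^sub>R w' (s p)
     - ((\<Sum>k\<in>UNIV. 2 * p$k * grad k p) / ?R) *\<^sub>R w' (s p)"
    by (simp add: conformal_laplacian_def sum.distrib scaleR_sum_left sum_divide_distrib)
  also have "\<dots> = (16 / N p) *\<^sub>R w'' (s p) + (8 / N p * ?A) *\<^sub>R w' (s p)"
  proof -
    have "(\<Sum>k\<in>UNIV. hess k k p) - (\<Sum>k\<in>UNIV. 2 * p$k * grad k p) / ?R = 8 / N p * ?A"
      unfolding laplacian_root[OF p] gradient_dot_radial[OF p]
      using R n by (simp add: add_divide_distrib)
    then show ?thesis
      by (simp add: gradient_norm[OF p] scaleR_left_diff_distrib[symmetric] add_diff_eq[symmetric])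
  qed
  also have "8 / N p * ?A = 16 / N p * (1/2 * ?A)"
    using N_nz[OF p] by (simp del: distrib_left_numeral)
  finally show ?thesis
    by (simp only: scaleR_add_right scaleR_scaleR)
qed

end

section \<open>Separation of variables\<close>

text \<open>The second derivative is continuous because the equation can be solved for it where its leading
  coefficient does not vanish.\<close>

lemma fuchsian_solutionE:
  assumes "fuchsian_solution a lam1 lam2 I w" "I \<inter> a ` {..3} = {}"
  obtains w' w'' where
    "\<And>s. s \<in> I \<Longrightarrow> (w has_vector_derivative w' s) (at s)"
    "\<And>s. s \<in> I \<Longrightarrow> (w' has_vector_derivative w'' s) (at s)"
    "continuous_on I w''"
    "\<And>s. s \<in> I \<Longrightarrow> w'' s + (1/2 * (1 / (s - a 0) + (\<Sum>k\<in>UNIV. 1 / (s - pole_of a k)))) *\<^sub>R w' s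
      = - ((3/16 * (of_real s)\<^sup>2 + lam1 * of_real s + lam2) * w s / of_real (\<Prod>j\<le>3. s - a j))"
proof -
  obtain w' w'' where w:
    "\<And>s. s \<in> I \<Longrightarrow> (w has_vector_derivative w' s) (at s)"
    "\<And>s. s \<in> I \<Longrightarrow> (w' has_vector_derivative w'' s) (at s)"
    "\<And>s. s \<in> I \<Longrightarrow> (\<Prod>j\<le>3. of_real (s - a j)) *
            (w'' s + 1/2 * (\<Sum>j\<le>3. 1 / of_real (s - a j)) * w' s)
          + (3/16 * (of_real s)\<^sup>2 + lam1 * of_real s + lam2) * w s = 0"
    using assms(1) unfolding fuchsian_solution_def by blast
  define A where "A s = 1/2 * (1 / (s - a 0) + (\<Sum>k\<in>UNIV. 1 / (s - pole_of a k)))" for s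
  define P where "P s = (\<Prod>j\<le>3. s - a j)" for s
  have np: "s \<noteq> a 0" "s \<noteq> a 1" "s \<noteq> a 2" "s \<noteq> a 3" if "s \<in> I" for s
    using assms(2) that by auto
  have P: "P s \<noteq> 0" if "s \<in> I" for s
    using np[OF that] by (simp add: P_def prod_atMost_3)
  have ode: "w'' s + A s *\<^sub>R w' s =
      - ((3/16 * (of_real s)\<^sup>2 + lam1 * of_real s + lam2) * w s / of_real (P s))" if "s \<in> I" for s
  proof -
    have "1/2 * (\<Sum>j\<le>3. 1 / complex_of_real (s - a j)) = of_real (A s)"
      by (simp add: A_def sum_atMost_3 sum_3 add.assoc)
    then have "of_real (P s) * (w'' s + A s *\<^sub>R w' s) =
        - ((3/16 * (of_real s)\<^sup>2 + lam1 * of_real s + lam2) * w s)"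
      using w(3)[OF that] by (simp add: P_def scaleR_conv_of_real eq_neg_iff_add_eq_0)
    then show ?thesis
      using P[OF that] by (simp add: field_simps)
  qed
  have cw: "continuous_on I w" "continuous_on I w'"
    using w(1,2) by (meson continuous_at_imp_continuous_on has_vector_derivative_continuous)+
  have "continuous_on I (\<lambda>s. - ((3/16 * (of_real s)\<^sup>2 + lam1 * of_real s + lam2) * w s / of_real (P s)) - A s *\<^sub>R w' s)"
    using cw P np unfolding A_def P_def sum_3 pole_of_simps
    by (intro continuous_intros) auto
  moreover have "w'' s = - ((3/16 * (of_real s)\<^sup>2 + lam1 * of_real s + lam2) * w s / of_real (P s)) - A s *\<^sub>R w' s"
    if "s \<in> I" for s
    using ode[OF that] by (simp add: eq_diff_eq)
  ultimately have "continuous_on I w''"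
    by (metis (no_types, lifting) continuous_on_cong)
  with w(1,2) ode show thesis
    using that unfolding A_def P_def by blast
qed

lemma open_T_region: "open T_region"
proof -
  have T: "T_region = {p::real^3. 0 < p$1} \<inter> {p. 0 < p$2} \<inter> {p. 0 < p$3} \<inter>
      {p. 1 < (p$1)\<^sup>2 + (p$2)\<^sup>2 + (p$3)\<^sup>2}"
    by (auto simp: T_region_def)
  show ?thesis
    unfolding T by (intro open_Int open_Collect_less continuous_intros)
qed

lemma cyclide_coords_root:
  assumes "a 0 < a 1" "a 1 < a 2" "a 2 < a 3" "p \<in> T_region"
    and "cyclide_coords a p = (s1, s2, s3)"
  shows "separated a s1 s2 s3" "\<And>s. s \<in> {s1, s2, s3} \<Longrightarrow> cyclide_fun a p s = 0"
proof -
  obtain t1 t2 t3 where t: "separated a t1 t2 t3" "\<And>s. s \<in> {t1, t2, t3} \<Longrightarrow> cyclide_fun a p s = 0"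
    using cyclide_roots_exist[OF assms(1-4)] by blast
  then have "(s1, s2, s3) = (t1, t2, t3)"
    using cyclide_coords_eqI[of a t1 t2 t3 p] assms(5) by metis
  then show "separated a s1 s2 s3" "\<And>s. s \<in> {s1, s2, s3} \<Longrightarrow> cyclide_fun a p s = 0"
    using t by auto
qed

text \<open>The left-hand side is what the conformal Laplacian makes of the product of the three factors,
  each of them replaced in turn by its image \<open>e\<close> under the Fuchsian equation.\<close>

lemma separation_of_variables:
  fixes s1 s2 s3 :: real and lam1 lam2 v1 v2 v3 :: complex
  assumes sep: "separated a s1 s2 s3" and zero: "\<And>s. s \<in> {s1, s2, s3} \<Longrightarrow> cyclide_fun a p s = 0"
  defines "e s v \<equiv> (16 / slope (a 0) (pole_of a) p s s) *\<^sub>R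
      (- ((3/16 * (of_real s)\<^sup>2 + lam1 * of_real s + lam2) * v / of_real (\<Prod>j\<le>3. s - a j)))"
  shows "v1 * (v2 * e s3 v3) + v1 * e s2 v2 * v3 + e s1 v1 * v2 * v3 =
    3 / of_real ((p \<bullet> p + 1)\<^sup>2) * (v1 * v2 * v3)"
proof -
  let ?R2 = "complex_of_real ((p \<bullet> p + 1)\<^sup>2)"
  let ?Q = "\<lambda>s. 3/16 * (complex_of_real s)\<^sup>2 + lam1 * of_real s + lam2"
  have d: "s1 \<noteq> s2" "s1 \<noteq> s3" "s2 \<noteq> s3"
    using sep by (auto simp: separated_def)
  have e: "e t v = 16 / ?R2 * (?Q t / ((of_real t - of_real t') * (of_real t - of_real t''))) * v"
    if "{s1, s2, s3} = {t, t', t''}" "t \<noteq> t'" "t \<noteq> t''" "t' \<noteq> t''" for t t' t'' v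
  proof -
    have "e t v = - (16 * ?Q t * v / of_real (slope (a 0) (pole_of a) p t t * (\<Prod>j\<le>3. t - a j)))"
      by (simp add: e_def scaleR_conv_of_real)
    also have "complex_of_real (slope (a 0) (pole_of a) p t t * (\<Prod>j\<le>3. t - a j)) =
        - (?R2 * ((of_real t - of_real t') * (of_real t - of_real t'')))"
      by (subst slope_at_root[OF sep zero that]) simp_all
    finally show ?thesis
      by simp
  qed
  have e1: "e s1 v1 = 16 / ?R2 * (?Q s1 / ((of_real s1 - of_real s2) * (of_real s1 - of_real s3))) * v1"
    by (rule e) (use d in auto)
  have e2: "e s2 v2 = 16 / ?R2 * (?Q s2 / ((of_real s2 - of_real s1) * (of_real s2 - of_real s3))) * v2"
    by (rule e) (use d in auto)
  have e3: "e s3 v3 = 16 / ?R2 * (?Q s3 / ((of_real s3 - of_real s1) * (of_real s3 - of_real s2))) * v3"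
    by (rule e) (use d in auto)
  have "v1 * (v2 * e s3 v3) + v1 * e s2 v2 * v3 + e s1 v1 * v2 * v3 = 16 / ?R2 * (v1 * v2 * v3) *
    (?Q s1 / ((of_real s1 - of_real s2) * (of_real s1 - of_real s3)) +
     ?Q s2 / ((of_real s2 - of_real s1) * (of_real s2 - of_real s3)) +
     ?Q s3 / ((of_real s3 - of_real s1) * (of_real s3 - of_real s2)))"
    unfolding e1 e2 e3 by (simp only: distrib_left mult_ac add_ac)
  also have "\<dots> = 16 / ?R2 * (v1 * v2 * v3) * (3/16)"
    by (subst cyclide_lagrange) (use d in auto)
  finally show ?thesis
    by simp
qed

theorem theorem4p1:
  fixes a :: "nat \<Rightarrow> real" and lam1 lam2 :: complex
    and w1 w2 w3 :: "real \<Rightarrow> complex"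
  assumes "a 0 < a 1" and "a 1 < a 2" and "a 2 < a 3"
    and "fuchsian_solution a lam1 lam2 {a 0<..<a 1} w1"
    and "fuchsian_solution a lam1 lam2 {a 1<..<a 2} w2"
    and "fuchsian_solution a lam1 lam2 {a 2<..<a 3} w3"
  shows "harmonic_on
    (\<lambda>p :: real^3. case cyclide_coords a p of (s1, s2, s3) \<Rightarrow>
       of_real (((p$1)^2 + (p$2)^2 + (p$3)^2 + 1) powr (-1/2)) * w1 s1 * w2 s2 * w3 s3)
    T_region"
proof -
  define s1 where "s1 p = fst (cyclide_coords a p)" for p
  define s2 where "s2 p = fst (snd (cyclide_coords a p))" for p
  define s3 where "s3 p = snd (snd (cyclide_coords a p))" for p
  have coords: "cyclide_coords a p = (s1 p, s2 p, s3 p)" for p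
    by (simp add: s1_def s2_def s3_def)
  have sep: "separated a (s1 p) (s2 p) (s3 p)" if "p \<in> T_region" for p
    by (rule cyclide_coords_root(1)[OF assms(1-3) that coords])
  have zero: "cyclide_fun a p s = 0" if "p \<in> T_region" "s \<in> {s1 p, s2 p, s3 p}" for p s
    by (rule cyclide_coords_root(2)[OF assms(1-3) that(1) coords that(2)])
  note facts = open_T_region sep[unfolded separated_def] zero[unfolded cyclide_fun_eq_level]
  interpret r1: cyclide_root T_region "a 0" "a 1" "a 0" "pole_of a" s1
    by unfold_locales (use facts assms(1-3) in \<open>auto simp: pole_of_def\<close>)
  interpret r2: cyclide_root T_region "a 1" "a 2" "a 0" "pole_of a" s2
    by unfold_locales (use facts assms(1-3) in \<open>auto simp: pole_of_def\<close>)
  interpret r3: cyclide_root T_region "a 2" "a 3" "a 0" "pole_of a" s3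
    by unfold_locales (use facts assms(1-3) in \<open>auto simp: pole_of_def\<close>)
  have at3: "{..3} = {0, 1, 2, 3::nat}"
    by auto
  have np: "{a 0<..<a 1} \<inter> a ` {..3} = {}" "{a 1<..<a 2} \<inter> a ` {..3} = {}" "{a 2<..<a 3} \<inter> a ` {..3} = {}"
    using assms(1-3) unfolding at3 by auto
  obtain w1' w1'' where w1: "\<And>s. s \<in> {a 0<..<a 1} \<Longrightarrow> (w1 has_vector_derivative w1' s) (at s)"
    "\<And>s. s \<in> {a 0<..<a 1} \<Longrightarrow> (w1' has_vector_derivative w1'' s) (at s)"
    "continuous_on {a 0<..<a 1} w1''"
    "\<And>s. s \<in> {a 0<..<a 1} \<Longrightarrow> w1'' s + (1/2 * (1 / (s - a 0) + (\<Sum>k\<in>UNIV. 1 / (s - pole_of a k)))) *\<^sub>R w1' s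
      = - ((3/16 * (of_real s)\<^sup>2 + lam1 * of_real s + lam2) * w1 s / of_real (\<Prod>j\<le>3. s - a j))"
    using fuchsian_solutionE[OF assms(4) np(1)] by blast
  obtain w2' w2'' where w2: "\<And>s. s \<in> {a 1<..<a 2} \<Longrightarrow> (w2 has_vector_derivative w2' s) (at s)"
    "\<And>s. s \<in> {a 1<..<a 2} \<Longrightarrow> (w2' has_vector_derivative w2'' s) (at s)"
    "continuous_on {a 1<..<a 2} w2''"
    "\<And>s. s \<in> {a 1<..<a 2} \<Longrightarrow> w2'' s + (1/2 * (1 / (s - a 0) + (\<Sum>k\<in>UNIV. 1 / (s - pole_of a k)))) *\<^sub>R w2' s
      = - ((3/16 * (of_real s)\<^sup>2 + lam1 * of_real s + lam2) * w2 s / of_real (\<Prod>j\<le>3. s - a j))"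
    using fuchsian_solutionE[OF assms(5) np(2)] by blast
  obtain w3' w3'' where w3: "\<And>s. s \<in> {a 2<..<a 3} \<Longrightarrow> (w3 has_vector_derivative w3' s) (at s)"
    "\<And>s. s \<in> {a 2<..<a 3} \<Longrightarrow> (w3' has_vector_derivative w3'' s) (at s)"
    "continuous_on {a 2<..<a 3} w3''"
    "\<And>s. s \<in> {a 2<..<a 3} \<Longrightarrow> w3'' s + (1/2 * (1 / (s - a 0) + (\<Sum>k\<in>UNIV. 1 / (s - pole_of a k)))) *\<^sub>R w3' s
      = - ((3/16 * (of_real s)\<^sup>2 + lam1 * of_real s + lam2) * w3 s / of_real (\<Prod>j\<le>3. s - a j))"
    using fuchsian_solutionE[OF assms(6) np(3)] by blast
  define g1 where "g1 k p = r1.grad k p *\<^sub>R w1' (s1 p)" for k p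
  define g2 where "g2 k p = r2.grad k p *\<^sub>R w2' (s2 p)" for k p
  define g3 where "g3 k p = r3.grad k p *\<^sub>R w3' (s3 p)" for k p
  define h1 where "h1 k l p = r1.grad k p *\<^sub>R (r1.grad l p *\<^sub>R w1'' (s1 p)) + r1.hess k l p *\<^sub>R w1' (s1 p)" for k l p
  define h2 where "h2 k l p = r2.grad k p *\<^sub>R (r2.grad l p *\<^sub>R w2'' (s2 p)) + r2.hess k l p *\<^sub>R w2' (s2 p)" for k l p
  define h3 where "h3 k l p = r3.grad k p *\<^sub>R (r3.grad l p *\<^sub>R w3'' (s3 p)) + r3.hess k l p *\<^sub>R w3' (s3 p)" for k l p
  have J1: "C2_with T_region (\<lambda>p. w1 (s1 p)) g1 h1"
    unfolding g1_def[abs_def] h1_def[abs_def]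
    by (rule C2_with_compose[OF r1.C2_root _ w1(1,2,3)]) (use r1.range in auto)
  have J2: "C2_with T_region (\<lambda>p. w2 (s2 p)) g2 h2"
    unfolding g2_def[abs_def] h2_def[abs_def]
    by (rule C2_with_compose[OF r2.C2_root _ w2(1,2,3)]) (use r2.range in auto)
  have J3: "C2_with T_region (\<lambda>p. w3 (s3 p)) g3 h3"
    unfolding g3_def[abs_def] h3_def[abs_def]
    by (rule C2_with_compose[OF r3.C2_root _ w3(1,2,3)]) (use r3.range in auto)
  obtain h0 where J0: "C2_with T_region weight weight_grad h0"
    and h0: "\<And>p::real^3. (\<Sum>k\<in>UNIV. h0 k k p) = - (3 / of_real ((p \<bullet> p + 1)\<^sup>2)) * weight p"
    by (rule weight_jet[of T_region]) simp
  \<comment> \<open>The derivatives of the product of the first two factors, and then of all three, as the product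
    rule writes them; this shape is what \<open>conformal_laplacian_mult\<close> applies to.\<close>
  define G12 where "G12 k p = w1 (s1 p) * g2 k p + g1 k p * w2 (s2 p)" for k p
  define H12 where "H12 k l p = (w1 (s1 p) * h2 k l p + g1 l p * g2 k p) +
      (g1 k p * g2 l p + h1 k l p * w2 (s2 p))" for k l p
  define G where "G k p = w1 (s1 p) * w2 (s2 p) * g3 k p + G12 k p * w3 (s3 p)" for k p
  define H where "H k l p = (w1 (s1 p) * w2 (s2 p) * h3 k l p + G12 l p * g3 k p) +
      (G12 k p * g3 l p + H12 k l p * w3 (s3 p))" for k l p
  have J12: "C2_with T_region (\<lambda>p. w1 (s1 p) * w2 (s2 p)) G12 H12"
    unfolding G12_def[abs_def] H12_def[abs_def] by (rule C2_with_mult[OF J1 J2])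
  have JW: "C2_with T_region (\<lambda>p. w1 (s1 p) * w2 (s2 p) * w3 (s3 p)) G H"
    unfolding G_def[abs_def] H_def[abs_def] by (rule C2_with_mult[OF J12 J3])
  have u: "(\<lambda>p. case cyclide_coords a p of (s1, s2, s3) \<Rightarrow>
       of_real (((p$1)^2 + (p$2)^2 + (p$3)^2 + 1) powr (-1/2)) * w1 s1 * w2 s2 * w3 s3) =
     (\<lambda>p. weight p * (w1 (s1 p) * w2 (s2 p) * w3 (s3 p)))"
    by (simp add: coords weight_def inner_self_3 mult.assoc fun_eq_iff)
  show ?thesis
    unfolding u
  proof (rule harmonic_onI[OF open_T_region C2_with_mult[OF J0 JW]])
    fix p assume p: "p \<in> T_region"
    have ne: "s1 p \<noteq> s2 p" "s1 p \<noteq> s3 p" "s2 p \<noteq> s3 p"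
      using sep[OF p] by (auto simp: separated_def)
    have orth: "(\<Sum>k\<in>UNIV. x k *\<^sub>R v * (y k *\<^sub>R v')) = 0" if "(\<Sum>k\<in>UNIV. x k * y k) = 0"
      for x y :: "3 \<Rightarrow> real" and v v' :: complex
    proof -
      have "(\<Sum>k\<in>UNIV. x k *\<^sub>R v * (y k *\<^sub>R v')) = (\<Sum>k\<in>UNIV. x k * y k) *\<^sub>R (v * v')"
        by (simp add: scaleR_sum_left mult.commute)
      then show ?thesis
        using that by simp
    qed
    have o12: "(\<Sum>k\<in>UNIV. g1 k p * g2 k p) = 0"
      unfolding g1_def g2_def
      by (intro orth gradients_orthogonal[OF r1.cyclide_root_axioms r2.cyclide_root_axioms p ne(1)])
    have o13: "(\<Sum>k\<in>UNIV. g1 k p * g3 k p) = 0"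
      unfolding g1_def g3_def
      by (intro orth gradients_orthogonal[OF r1.cyclide_root_axioms r3.cyclide_root_axioms p ne(2)])
    have o23: "(\<Sum>k\<in>UNIV. g2 k p * g3 k p) = 0"
      unfolding g2_def g3_def
      by (intro orth gradients_orthogonal[OF r2.cyclide_root_axioms r3.cyclide_root_axioms p ne(3)])
    have o123: "(\<Sum>k\<in>UNIV. G12 k p * g3 k p) = 0"
    proof -
      have "(\<Sum>k\<in>UNIV. G12 k p * g3 k p) =
          w1 (s1 p) * (\<Sum>k\<in>UNIV. g2 k p * g3 k p) + w2 (s2 p) * (\<Sum>k\<in>UNIV. g1 k p * g3 k p)"
        by (simp add: G12_def sum_distrib_left sum.distrib algebra_simps)
      then show ?thesis
        by (simp add: o13 o23)
    qed
    let ?e = "\<lambda>s v. (16 / slope (a 0) (pole_of a) p s s) *\<^sub>R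
      (- ((3/16 * (of_real s)\<^sup>2 + lam1 * of_real s + lam2) * v / of_real (\<Prod>j\<le>3. s - a j)))"
    have c1: "conformal_laplacian g1 h1 p = ?e (s1 p) (w1 (s1 p))"
      unfolding g1_def[abs_def] h1_def[abs_def]
      by (subst r1.conformal_laplacian_compose[OF p]) (use r1.range[OF p] w1(4) in \<open>simp_all add: r1.N_def\<close>)
    have c2: "conformal_laplacian g2 h2 p = ?e (s2 p) (w2 (s2 p))"
      unfolding g2_def[abs_def] h2_def[abs_def]
      by (subst r2.conformal_laplacian_compose[OF p]) (use r2.range[OF p] w2(4) in \<open>simp_all add: r2.N_def\<close>)
    have c3: "conformal_laplacian g3 h3 p = ?e (s3 p) (w3 (s3 p))"
      unfolding g3_def[abs_def] h3_def[abs_def]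
      by (subst r3.conformal_laplacian_compose[OF p]) (use r3.range[OF p] w3(4) in \<open>simp_all add: r3.N_def\<close>)
    have "conformal_laplacian G12 H12 p =
        w1 (s1 p) * conformal_laplacian g2 h2 p + conformal_laplacian g1 h1 p * w2 (s2 p)"
      unfolding G12_def[abs_def] H12_def[abs_def] by (rule conformal_laplacian_mult[where g = g1 and g' = g2 and p = p, OF o12])
    moreover have "conformal_laplacian G H p =
        w1 (s1 p) * w2 (s2 p) * conformal_laplacian g3 h3 p + conformal_laplacian G12 H12 p * w3 (s3 p)"
      unfolding G_def[abs_def] H_def[abs_def]
      by (rule conformal_laplacian_mult[where g = G12 and g' = g3 and p = p, OF o123])
    ultimately have "conformal_laplacian G H p =
        w1 (s1 p) * (w2 (s2 p) * ?e (s3 p) (w3 (s3 p))) + w1 (s1 p) * ?e (s2 p) (w2 (s2 p)) * w3 (s3 p)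
          + ?e (s1 p) (w1 (s1 p)) * w2 (s2 p) * w3 (s3 p)"
      unfolding c1 c2 c3 by (simp only: distrib_right mult.assoc add.assoc)
    also have "\<dots> = 3 / of_real ((p \<bullet> p + 1)\<^sup>2) * (w1 (s1 p) * w2 (s2 p) * w3 (s3 p))"
      by (rule separation_of_variables[OF sep[OF p] zero[OF p]])
    finally show "(\<Sum>k\<in>UNIV. (weight p * H k k p + weight_grad k p * G k p) +
        (weight_grad k p * G k p + h0 k k p * (w1 (s1 p) * w2 (s2 p) * w3 (s3 p)))) = 0"
      by (subst laplacian_weight_mult[where h = h0, OF h0]) simp
  qed
qed

end
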